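(* Let $n\ge 1$, let $M$ be a smooth oriented $n$-manifold and let $(f,\xi)$, $f:M\to\mathbb{R}^{n+1}$, be a non-degenerate equiaffine immersion with affine shape operator $S$ satisfying $\det(S)\neq 0$ at every point. Let $\nu:M\to(\mathbb{R}^{n+1})^*$ be its conormal map. Then the map $\sigma^-:=(-\xi,\nu)$ takes values in $\mathbb{H}^{n+1,n}$ and is a horizontal and $\phi$-anti-invariant immersion, whose induced metric coincides with the affine metric of the dual immersion $\nu$ (namely $-\bar h$). Moreover, $\bar\sigma:=\pi_-\circ\sigma^-:M\to\mathbb{H}^n_\tau$ is a non-degenerate Lagrangian immersion.
   Context: Everything is smooth. $D$ and $D^*$ are the flat connections on $\mathbb{R}^{n+1}$ and $(\mathbb{R}^{n+1})^*$. Affine immersions. Let $f:M\to\mathbb{R}^{n+1}$ be an immersion with a vector field $\xi:M\to\mathbb{R}^{n+1}$ such that $\mathbb{R}^{n+1}=f_*(T_pM)\oplus\mathbb{R}\xi_p$ for all $p$. Write $D_Xf_*Y=f_*(\nabla_XY)+h(X,Y)\xi$ and $D_X\xi=-f_*(SX)+\tau(X)\xi$; $h$ is the affine metric, $S$ the affine shape operator. $(f,\xi)$ is equiaffine if $\tau=0$, and non-degenerate if $h$ is non-degenerate. The conormal map $\nu:M\to(\mathbb{R}^{n+1})^*$ is defined by $\nu_p(\xi_p)=1$, $\nu_p(f_*X)=0$ for $X\in T_pM$. It is an immersion, transverse to its position vector, with structure equation $D^*_X\nu_*Y=\nu_*(\bar\nabla_XY)-\bar h(X,Y)\nu$; its affine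 metric (with transversal field $\nu$) is thus $-\bar h$, and $\bar h(X,Y)=h(SX,Y)$. Pseudohyperbolic space. $V=\mathbb{R}^{n+1}\oplus(\mathbb{R}^{n+1})^*$ with $\hat{\mathbf g}((v,\alpha),(w,\beta))=\tfrac12(\alpha(w)+\beta(v))$ of signature $(n+1,n+1)$. $\mathbb{H}^{n+1,n}=\{(v,\alpha)\in V: \alpha(v)=-1\}$ with the restricted metric $g$ of signature $(n+1,n)$. At $z=(v,\alpha)$ put $\zeta_z=(v,-\alpha)\in T_z\mathbb{H}^{n+1,n}$. The horizontal space is the $g$-orthogonal complement of $\zeta_z$ in $T_z\mathbb{H}^{n+1,n}$: $\mathcal{H}_z=\{(w,\beta):\alpha(w)=0=\beta(v)\}$. The endomorphism $\phi$ of $T\mathbb{H}^{n+1,n}$ is given by $\phi(\zeta)=0$ and $\phi(w,\beta)=(w,-\beta)$ on $\mathcal{H}$. An immersion $\sigma:M\to\mathbb{H}^{n+1,n}$ is horizontal if $\sigma_*(X)\in\mathcal{H}$ for all $X$, and $\phi$-anti-invariant if $g(\phi(\sigma_*X),\sigma_*Y)=0$ for all $X,Y\in\Gamma(TM)$. Para-complex hyperbolic space. $\mathbb{R}$ acts freely and properly by isometries on $\mathbb{H}^{n+1,n}$ via $t\cdot(v,\alpha)=(e^tv,e^{-t}\alpha)$; $\pi_-:\mathbb{H}^{n+1,n}\to\mathbb{H}^n_\tau:=\mathbb{H}^{n+1,n}/\mathbb{R}$ is the quotient principal $\mathbb{R}$-bundle. $\mathbb{H}^n_\tau$ carries the para-Kähler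 structure $(\mathbf g,\mathbf P,\boldsymbol\omega)$, where $\mathbf g$ (signature $(n,n)$), $\mathbf P$ and $\boldsymbol\omega=\mathbf g(\cdot,\mathbf P\cdot)$ are the tensors corresponding to $g|_{\mathcal H}$, $\phi|_{\mathcal H}$ and $g(\cdot,\phi\cdot)|_{\mathcal H}$ under the isomorphisms $d\pi_-:\mathcal{H}_z\to T_{\pi_-(z)}\mathbb{H}^n_\tau$. An immersion of an $n$-manifold into $\mathbb{H}^n_\tau$ is Lagrangian if it pulls $\boldsymbol\omega$ back to $0$, and non-degenerate if its induced metric is non-degenerate. *)

theory Defs
  imports "HOL-Analysis.Analysis"
begin

section \<open>Smooth maps between finite-dimensional normed spaces\<close>

text \<open>
  The predicate \<open>Ck_on k S f\<close> asks for all iterated directional derivatives up to order \<open>k\<close>.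
  It is used only for open \<open>S\<close> in finite-dimensional spaces, where this is
  the usual notion of a \<open>k\<close> times continuously differentiable map.
\<close>

fun Ck_on :: "nat \<Rightarrow> 'a::real_normed_vector set \<Rightarrow> ('a \<Rightarrow> 'b::real_normed_vector) \<Rightarrow> bool" where
  "Ck_on 0 S f \<longleftrightarrow> continuous_on S f"
| "Ck_on (Suc k) S f \<longleftrightarrow>
     (\<forall>x\<in>S. f differentiable (at x)) \<and> (\<forall>v. Ck_on k S (\<lambda>x. frechet_derivative f (at x) v))"

definition smooth_on :: "'a::real_normed_vector set \<Rightarrow> ('a \<Rightarrow> 'b::real_normed_vector) \<Rightarrow> bool" where
  "smooth_on S f \<longleftrightarrow> (\<forall>k. Ck_on k S f)"


section \<open>Smooth manifolds\<close>

text \<open>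
  A manifold is a topology \<open>M\<close> together with an atlas \<open>A\<close> (not necessarily maximal).
  A chart is a pair of its domain and its coordinate map into the model space \<open>'e\<close>;
  the coordinate map is only meaningful on the domain.
\<close>

type_synonym ('a, 'e) chart = "'a set \<times> ('a \<Rightarrow> 'e)"

definition chart_inv :: "('a, 'e) chart \<Rightarrow> 'e \<Rightarrow> 'a" where
  "chart_inv c = inv_into (fst c) (snd c)"

definition is_chart :: "'a topology \<Rightarrow> ('a, 'e::euclidean_space) chart \<Rightarrow> bool" where
  "is_chart M c \<longleftrightarrow> openin M (fst c) \<and> open (snd c ` fst c) \<and>
     homeomorphic_map (subtopology M (fst c)) (top_of_set (snd c ` fst c)) (snd c)"

definition smooth_manifold :: "'a topology \<Rightarrow> ('a, 'e::euclidean_space) chart set \<Rightarrow> bool" where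
  "smooth_manifold M A \<longleftrightarrow>
     Hausdorff_space M \<and> second_countable M \<and>
     (\<forall>c\<in>A. is_chart M c) \<and> topspace M = (\<Union>c\<in>A. fst c) \<and>
     (\<forall>c\<in>A. \<forall>d\<in>A. smooth_on (snd c ` (fst c \<inter> fst d)) (snd d \<circ> chart_inv c))"

text \<open>An orientation is given by an atlas whose transition maps preserve orientation.\<close>

definition oriented_manifold :: "'a topology \<Rightarrow> ('a, real^'n) chart set \<Rightarrow> bool" where
  "oriented_manifold M A \<longleftrightarrow> smooth_manifold M A \<and>
     (\<forall>c\<in>A. \<forall>d\<in>A. \<forall>x\<in>snd c ` (fst c \<inter> fst d).
        0 < det (matrix (frechet_derivative (snd d \<circ> chart_inv c) (at x))))"

text \<open>
  The tangent space at \<open>p\<close> is identified with the model space \<open>'e\<close> by means of one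
  preferred chart \<open>chart_at A p\<close> around \<open>p\<close>. Thus an element \<open>X\<close> of \<open>'e\<close>, viewed
  as a tangent vector at \<open>p\<close>, has components \<open>mdiff A (snd c) p X\<close> in
  any other chart \<open>c\<close> around \<open>p\<close>.
\<close>

definition chart_at :: "('a, 'e) chart set \<Rightarrow> 'a \<Rightarrow> ('a, 'e) chart" where
  "chart_at A p = (SOME c. c \<in> A \<and> p \<in> fst c)"

text \<open>Differential at \<open>p\<close> of a map into a normed space, as a map on the tangent space at \<open>p\<close>.\<close>

definition mdiff ::
  "('a, 'e::euclidean_space) chart set \<Rightarrow> ('a \<Rightarrow> 'b::real_normed_vector) \<Rightarrow> 'a \<Rightarrow> 'e \<Rightarrow> 'b" where
  "mdiff A f p = frechet_derivative (f \<circ> chart_inv (chart_at A p)) (at (snd (chart_at A p) p))"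

definition smooth_map ::
  "('a, 'e::euclidean_space) chart set \<Rightarrow> ('a \<Rightarrow> 'b::real_normed_vector) \<Rightarrow> bool" where
  "smooth_map A f \<longleftrightarrow> (\<forall>c\<in>A. smooth_on (snd c ` fst c) (f \<circ> chart_inv c))"

definition immersion ::
  "'a topology \<Rightarrow> ('a, 'e::euclidean_space) chart set \<Rightarrow> ('a \<Rightarrow> 'b::real_normed_vector) \<Rightarrow> bool" where
  "immersion M A f \<longleftrightarrow> smooth_map A f \<and> (\<forall>p\<in>topspace M. inj (mdiff A f p))"

text \<open>Maps between two manifolds with atlases \<open>A\<close> and \<open>B\<close>.\<close>

definition mdiff2 ::
  "('a, 'e::euclidean_space) chart set \<Rightarrow> ('b, 'd::euclidean_space) chart set \<Rightarrow>
     ('a \<Rightarrow> 'b) \<Rightarrow> 'a \<Rightarrow> 'e \<Rightarrow> 'd" where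
  "mdiff2 A B F p = mdiff A (snd (chart_at B (F p)) \<circ> F) p"

definition smooth_map2 ::
  "'a topology \<Rightarrow> ('a, 'e::euclidean_space) chart set \<Rightarrow> ('b, 'd::euclidean_space) chart set \<Rightarrow>
     ('a \<Rightarrow> 'b) \<Rightarrow> bool" where
  "smooth_map2 M A B F \<longleftrightarrow>
     (\<forall>p\<in>topspace M. \<exists>c\<in>A. \<exists>d\<in>B. \<exists>W. openin M W \<and> p \<in> W \<and> W \<subseteq> fst c \<and> F ` W \<subseteq> fst d \<and>
        smooth_on (snd c ` W) (snd d \<circ> F \<circ> chart_inv c))"

definition immersion2 ::
  "'a topology \<Rightarrow> ('a, 'e::euclidean_space) chart set \<Rightarrow> ('b, 'd::euclidean_space) chart set \<Rightarrow>
     ('a \<Rightarrow> 'b) \<Rightarrow> bool" where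
  "immersion2 M A B F \<longleftrightarrow> smooth_map2 M A B F \<and> (\<forall>p\<in>topspace M. inj (mdiff2 A B F p))"

text \<open>Pull-back of a field \<open>b\<close> of bilinear forms along a map between manifolds.\<close>

definition pullback_form ::
  "('a, 'e::euclidean_space) chart set \<Rightarrow> ('b, 'd::euclidean_space) chart set \<Rightarrow> ('a \<Rightarrow> 'b) \<Rightarrow>
     ('b \<Rightarrow> 'd \<Rightarrow> 'd \<Rightarrow> real) \<Rightarrow> 'a \<Rightarrow> 'e \<Rightarrow> 'e \<Rightarrow> real" where
  "pullback_form A B F b p X Y = b (F p) (mdiff2 A B F p X) (mdiff2 A B F p Y)"

definition nondegenerate_form :: "('e::real_vector \<Rightarrow> 'e \<Rightarrow> real) \<Rightarrow> bool" where
  "nondegenerate_form b \<longleftrightarrow> (\<forall>X. (\<forall>Y. b X Y = 0) \<longrightarrow> X = 0)"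

text \<open>Smooth vector fields on an open subset \<open>U\<close>: their components in every chart are smooth.\<close>

definition smooth_vector_field ::
  "'a topology \<Rightarrow> ('a, 'e::euclidean_space) chart set \<Rightarrow> 'a set \<Rightarrow> ('a \<Rightarrow> 'e) \<Rightarrow> bool" where
  "smooth_vector_field M A U Y \<longleftrightarrow> openin M U \<and>
     (\<forall>c\<in>A. smooth_on (snd c ` (fst c \<inter> U))
        ((\<lambda>q. mdiff A (snd c) q (Y q)) \<circ> chart_inv c))"


section \<open>Affine immersions\<close>

definition affine_immersion ::
  "'a topology \<Rightarrow> ('a, 'e::euclidean_space) chart set \<Rightarrow> ('a \<Rightarrow> 'b::real_normed_vector) \<Rightarrow>
     ('a \<Rightarrow> 'b) \<Rightarrow> bool" where
  "affine_immersion M A f \<xi> \<longleftrightarrow> immersion M A f \<and> smooth_map A \<xi> \<and>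
     (\<forall>p\<in>topspace M. range (mdiff A f p) \<inter> span {\<xi> p} = {0} \<and>
        {u + v |u v. u \<in> range (mdiff A f p) \<and> v \<in> span {\<xi> p}} = UNIV)"

text \<open>Components of \<open>w\<close> in the decomposition \<open>w = f\<^sub>* X + t \<xi>\<close> at \<open>p\<close>.\<close>

definition tangential_part ::
  "('a, 'e::euclidean_space) chart set \<Rightarrow> ('a \<Rightarrow> 'b::real_normed_vector) \<Rightarrow> ('a \<Rightarrow> 'b) \<Rightarrow>
     'a \<Rightarrow> 'b \<Rightarrow> 'e" where
  "tangential_part A f \<xi> p w = (THE X. \<exists>t. w = mdiff A f p X + t *\<^sub>R \<xi> p)"

definition transversal_part ::
  "('a, 'e::euclidean_space) chart set \<Rightarrow> ('a \<Rightarrow> 'b::real_normed_vector) \<Rightarrow> ('a \<Rightarrow> 'b) \<Rightarrow>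
     'a \<Rightarrow> 'b \<Rightarrow> real" where
  "transversal_part A f \<xi> p w = (THE t. \<exists>X. w = mdiff A f p X + t *\<^sub>R \<xi> p)"

text \<open>
  The affine metric \<open>h\<close> at \<open>p\<close> on tangent vectors \<open>X\<close>, \<open>Y\<close>: the \<open>\<xi>\<close>-component of
  \<open>D\<^sub>X f\<^sub>*Y'\<close> for all local smooth vector fields \<open>Y'\<close> with value \<open>Y\<close> at \<open>p\<close>.
\<close>

definition affine_metric ::
  "'a topology \<Rightarrow> ('a, 'e::euclidean_space) chart set \<Rightarrow> ('a \<Rightarrow> 'b::real_normed_vector) \<Rightarrow>
     ('a \<Rightarrow> 'b) \<Rightarrow> 'a \<Rightarrow> 'e \<Rightarrow> 'e \<Rightarrow> real" where
  "affine_metric M A f \<xi> p X Y = (THE t. \<forall>U Y'.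
     p \<in> U \<and> smooth_vector_field M A U Y' \<and> Y' p = Y \<longrightarrow>
     t = transversal_part A f \<xi> p (mdiff A (\<lambda>q. mdiff A f q (Y' q)) p X))"

definition affine_shape ::
  "('a, 'e::euclidean_space) chart set \<Rightarrow> ('a \<Rightarrow> 'b::real_normed_vector) \<Rightarrow> ('a \<Rightarrow> 'b) \<Rightarrow>
     'a \<Rightarrow> 'e \<Rightarrow> 'e" where
  "affine_shape A f \<xi> p X = - tangential_part A f \<xi> p (mdiff A \<xi> p X)"

definition transversal_form ::
  "('a, 'e::euclidean_space) chart set \<Rightarrow> ('a \<Rightarrow> 'b::real_normed_vector) \<Rightarrow> ('a \<Rightarrow> 'b) \<Rightarrow>
     'a \<Rightarrow> 'e \<Rightarrow> real" where
  "transversal_form A f \<xi> p X = transversal_part A f \<xi> p (mdiff A \<xi> p X)"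

definition equiaffine_immersion ::
  "'a topology \<Rightarrow> ('a, 'e::euclidean_space) chart set \<Rightarrow> ('a \<Rightarrow> 'b::real_normed_vector) \<Rightarrow>
     ('a \<Rightarrow> 'b) \<Rightarrow> bool" where
  "equiaffine_immersion M A f \<xi> \<longleftrightarrow> affine_immersion M A f \<xi> \<and>
     (\<forall>p\<in>topspace M. \<forall>X. transversal_form A f \<xi> p X = 0)"

definition nondegenerate_affine ::
  "'a topology \<Rightarrow> ('a, 'e::euclidean_space) chart set \<Rightarrow> ('a \<Rightarrow> 'b::real_normed_vector) \<Rightarrow>
     ('a \<Rightarrow> 'b) \<Rightarrow> bool" where
  "nondegenerate_affine M A f \<xi> \<longleftrightarrow>
     (\<forall>p\<in>topspace M. nondegenerate_form (affine_metric M A f \<xi> p))"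

definition conormal ::
  "('a, 'e::euclidean_space) chart set \<Rightarrow> ('a \<Rightarrow> 'b::real_normed_vector) \<Rightarrow> ('a \<Rightarrow> 'b) \<Rightarrow>
     'a \<Rightarrow> ('b \<Rightarrow>\<^sub>L real)" where
  "conormal A f \<xi> p = (THE \<alpha>. blinfun_apply \<alpha> (\<xi> p) = 1 \<and>
     (\<forall>X. blinfun_apply \<alpha> (mdiff A f p X) = 0))"

text \<open>The form \<open>h(S X, Y)\<close>, written with a bar over \<open>h\<close> in the literature.\<close>

definition dual_form ::
  "'a topology \<Rightarrow> ('a, 'e::euclidean_space) chart set \<Rightarrow> ('a \<Rightarrow> 'b::real_normed_vector) \<Rightarrow>
     ('a \<Rightarrow> 'b) \<Rightarrow> 'a \<Rightarrow> 'e \<Rightarrow> 'e \<Rightarrow> real" where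
  "dual_form M A f \<xi> p X Y = affine_metric M A f \<xi> p (affine_shape A f \<xi> p X) Y"


section \<open>The pseudohyperbolic space\<close>

text \<open>The space \<open>V\<close>, the direct sum of a space and its dual.\<close>

type_synonym 'v bispace = "'v \<times> ('v \<Rightarrow>\<^sub>L real)"

definition neutral_metric ::
  "'v::euclidean_space bispace \<Rightarrow> 'v bispace \<Rightarrow> real" where
  "neutral_metric x y = (blinfun_apply (snd x) (fst y) + blinfun_apply (snd y) (fst x)) / 2"

definition pseudohyp :: "'v::euclidean_space bispace set" where
  "pseudohyp = {z. blinfun_apply (snd z) (fst z) = - 1}"

text \<open>
  The tangent space of the level set \<open>pseudohyp\<close> at \<open>z\<close>, as a subspace of \<open>V\<close>:
  the kernel of the differential of its defining function.
\<close>

definition pseudohyp_tangent :: "'v::euclidean_space bispace \<Rightarrow> 'v bispace set" where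
  "pseudohyp_tangent z = {X. blinfun_apply (snd z) (fst X) + blinfun_apply (snd X) (fst z) = 0}"

definition reeb :: "'v::euclidean_space bispace \<Rightarrow> 'v bispace" where
  "reeb z = (fst z, - snd z)"

definition horizontal :: "'v::euclidean_space bispace \<Rightarrow> 'v bispace set" where
  "horizontal z = {X \<in> pseudohyp_tangent z. neutral_metric X (reeb z) = 0}"

lemma horizontal_iff:
  "X \<in> horizontal z \<longleftrightarrow>
     blinfun_apply (snd z) (fst X) = 0 \<and> blinfun_apply (snd X) (fst z) = 0"
  by (auto simp: horizontal_def pseudohyp_tangent_def neutral_metric_def reeb_def
      uminus_blinfun.rep_eq)

text \<open>
  For \<open>X\<close> tangent to \<open>pseudohyp\<close> at \<open>z\<close> the horizontal component is \<open>X + snd z (fst X) \<zeta>\<close>,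
  with \<open>\<zeta> = reeb z\<close>; the lemmas below confirm that \<open>phi\<close> kills \<open>\<zeta>\<close> and is \<open>(w, - \<beta>)\<close> on
  horizontal vectors \<open>(w, \<beta>)\<close>.
\<close>

definition phi :: "'v::euclidean_space bispace \<Rightarrow> 'v bispace \<Rightarrow> 'v bispace" where
  "phi z X = (let Y = X + blinfun_apply (snd z) (fst X) *\<^sub>R reeb z in (fst Y, - snd Y))"

lemma phi_reeb: "z \<in> pseudohyp \<Longrightarrow> phi z (reeb z) = 0"
  by (simp add: phi_def pseudohyp_def reeb_def zero_prod_def)

lemma phi_horizontal: "X \<in> horizontal z \<Longrightarrow> phi z X = (fst X, - snd X)"
  by (simp add: phi_def horizontal_iff)

lemma linear_phi: "linear (phi z)"
  by (rule linearI)
    (simp_all add: phi_def reeb_def blinfun.add_right blinfun.scaleR_right algebra_simps)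

text \<open>As \<open>pseudohyp\<close> is an embedded hypersurface, immersions into it are immersions into the
  ambient space with values in it.\<close>

definition immersion_into_pseudohyp ::
  "'a topology \<Rightarrow> ('a, 'e::euclidean_space) chart set \<Rightarrow> ('a \<Rightarrow> 'v::euclidean_space bispace) \<Rightarrow> bool"
  where
  "immersion_into_pseudohyp M A \<sigma> \<longleftrightarrow> immersion M A \<sigma> \<and> \<sigma> ` topspace M \<subseteq> pseudohyp"

definition is_horizontal ::
  "'a topology \<Rightarrow> ('a, 'e::euclidean_space) chart set \<Rightarrow> ('a \<Rightarrow> 'v::euclidean_space bispace) \<Rightarrow> bool"
  where
  "is_horizontal M A \<sigma> \<longleftrightarrow> (\<forall>p\<in>topspace M. \<forall>X. mdiff A \<sigma> p X \<in> horizontal (\<sigma> p))"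

definition phi_anti_invariant ::
  "'a topology \<Rightarrow> ('a, 'e::euclidean_space) chart set \<Rightarrow> ('a \<Rightarrow> 'v::euclidean_space bispace) \<Rightarrow> bool"
  where
  "phi_anti_invariant M A \<sigma> \<longleftrightarrow> (\<forall>p\<in>topspace M. \<forall>X Y.
     neutral_metric (phi (\<sigma> p) (mdiff A \<sigma> p X)) (mdiff A \<sigma> p Y) = 0)"

definition induced_metric ::
  "('a, 'e::euclidean_space) chart set \<Rightarrow> ('a \<Rightarrow> 'v::euclidean_space bispace) \<Rightarrow> 'a \<Rightarrow> 'e \<Rightarrow> 'e \<Rightarrow> real"
  where
  "induced_metric A \<sigma> p X Y = neutral_metric (mdiff A \<sigma> p X) (mdiff A \<sigma> p Y)"

definition sigma_minus ::
  "('a, 'e::euclidean_space) chart set \<Rightarrow> ('a \<Rightarrow> 'v::euclidean_space) \<Rightarrow> ('a \<Rightarrow> 'v) \<Rightarrow>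
     'a \<Rightarrow> 'v bispace" where
  "sigma_minus A f \<xi> p = (- \<xi> p, conormal A f \<xi> p)"


section \<open>The para-complex hyperbolic space\<close>

text \<open>Points of the quotient are the orbits of the action of the reals.\<close>

definition act :: "real \<Rightarrow> 'v::euclidean_space bispace \<Rightarrow> 'v bispace" where
  "act t z = (exp t *\<^sub>R fst z, exp (- t) *\<^sub>R snd z)"

definition pi_minus :: "'v::euclidean_space bispace \<Rightarrow> 'v bispace set" where
  "pi_minus z = range (\<lambda>t. act t z)"

definition parahyp :: "'v::euclidean_space bispace set set" where
  "parahyp = pi_minus ` pseudohyp"

definition parahyp_topology :: "'v::euclidean_space bispace set topology" where
  "parahyp_topology = topology (\<lambda>U. U \<subseteq> parahyp \<and>
     openin (top_of_set pseudohyp) {z \<in> pseudohyp. pi_minus z \<in> U})"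

lemma openin_parahyp_topology:
  fixes U :: "'v::euclidean_space bispace set set"
  shows "openin parahyp_topology U \<longleftrightarrow>
     U \<subseteq> parahyp \<and> openin (top_of_set pseudohyp) {z \<in> pseudohyp. pi_minus z \<in> U}"
proof -
  let ?P = "\<lambda>U :: 'v bispace set set. U \<subseteq> parahyp \<and> openin (top_of_set pseudohyp) {z \<in> pseudohyp. pi_minus z \<in> U}"
  have "istopology ?P"
    unfolding istopology_def
  proof (intro conjI allI impI)
    fix S T assume "?P S" "?P T"
    moreover have "{z \<in> pseudohyp. pi_minus z \<in> S \<inter> T} =
      {z \<in> pseudohyp. pi_minus z \<in> S} \<inter> {z \<in> pseudohyp. pi_minus z \<in> T}" by auto
    ultimately show "S \<inter> T \<subseteq> parahyp"
      "openin (top_of_set pseudohyp) {z \<in> pseudohyp. pi_minus z \<in> S \<inter> T}"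
      by (auto intro: openin_Int)
  next
    fix K assume K: "\<forall>S\<in>K. ?P S"
    have "{z \<in> pseudohyp. pi_minus z \<in> \<Union>K} = (\<Union>S\<in>K. {z \<in> pseudohyp. pi_minus z \<in> S})" by auto
    with K show "\<Union>K \<subseteq> parahyp"
      "openin (top_of_set pseudohyp) {z \<in> pseudohyp. pi_minus z \<in> \<Union>K}"
      by auto
  qed
  then show ?thesis by (simp add: parahyp_topology_def)
qed

text \<open>
  The smooth structure for which \<open>pi_minus\<close> is a smooth submersion, as a maximal atlas:
  a map \<open>\<psi>\<close> on an open set \<open>U\<close> is a chart if it is injective with open image,
  \<open>\<psi> \<circ> pi_minus\<close> is smooth (locally the restriction of a smooth map defined on an
  open subset of \<open>V\<close>), and the inverse of \<open>\<psi>\<close> lifts locally to smooth maps into \<open>pseudohyp\<close>.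
\<close>

definition parahyp_atlas :: "('v::euclidean_space bispace set, 'e::euclidean_space) chart set" where
  "parahyp_atlas = {(U, \<psi>). openin parahyp_topology U \<and> inj_on \<psi> U \<and> open (\<psi> ` U) \<and>
     (\<forall>z\<in>pseudohyp. pi_minus z \<in> U \<longrightarrow>
        (\<exists>W G. open W \<and> z \<in> W \<and> smooth_on W G \<and>
           (\<forall>y\<in>W \<inter> pseudohyp. pi_minus y \<in> U \<longrightarrow> G y = \<psi> (pi_minus y)))) \<and>
     (\<forall>x\<in>\<psi> ` U. \<exists>W s. open W \<and> x \<in> W \<and> smooth_on W s \<and>
        (\<forall>y\<in>W. s y \<in> pseudohyp \<and> pi_minus (s y) \<in> U \<and> \<psi> (pi_minus (s y)) = y))}"

text \<open>
  The differential of \<open>pi_minus\<close> at \<open>z\<close>. The derivative within \<open>pseudohyp\<close> is determined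
  on \<open>pseudohyp_tangent z\<close> only, and it is used only there.
\<close>

definition dpi_minus :: "'v::euclidean_space bispace \<Rightarrow> 'v bispace \<Rightarrow> 'e::euclidean_space" where
  "dpi_minus z = frechet_derivative
     (snd (chart_at (parahyp_atlas :: ('v bispace set, 'e) chart set) (pi_minus z)) \<circ> pi_minus)
     (at z within pseudohyp)"

definition horizontal_lift :: "'v::euclidean_space bispace \<Rightarrow> 'e::euclidean_space \<Rightarrow> 'v bispace" where
  "horizontal_lift z = the_inv_into (horizontal z) (dpi_minus z)"

text \<open>
  The tensors on the quotient. As the action preserves the tensors upstairs and the
  horizontal spaces, it does not matter which point \<open>z\<close> of the orbit \<open>x\<close> is chosen.
\<close>

definition parahyp_metric ::
  "'v::euclidean_space bispace set \<Rightarrow> 'e::euclidean_space \<Rightarrow> 'e \<Rightarrow> real" where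
  "parahyp_metric x X Y = (let z = (SOME z. z \<in> x) in
     neutral_metric (horizontal_lift z X) (horizontal_lift z Y))"

definition parahyp_P ::
  "'v::euclidean_space bispace set \<Rightarrow> 'e::euclidean_space \<Rightarrow> 'e" where
  "parahyp_P x X = (let z = (SOME z. z \<in> x) in dpi_minus z (phi z (horizontal_lift z X)))"

definition parahyp_omega ::
  "'v::euclidean_space bispace set \<Rightarrow> 'e::euclidean_space \<Rightarrow> 'e \<Rightarrow> real" where
  "parahyp_omega x X Y = parahyp_metric x X (parahyp_P x Y)"

text \<open>
  The model space \<open>(real^'n) \<times> (real^'n)\<close> for the quotient fixes its dimension to be twice
  that of the source manifold, as required of a Lagrangian immersion.
\<close>

definition lagrangian_immersion ::
  "'a topology \<Rightarrow> ('a, real^'n) chart set \<Rightarrow> ('a \<Rightarrow> 'v::euclidean_space bispace set) \<Rightarrow> bool" where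
  "lagrangian_immersion M A F \<longleftrightarrow>
     (let B = (parahyp_atlas :: ('v bispace set, (real^'n) \<times> (real^'n)) chart set) in
      immersion2 M A B F \<and>
      (\<forall>p\<in>topspace M. \<forall>X Y. pullback_form A B F parahyp_omega p X Y = 0))"

definition nondegenerate_immersion ::
  "'a topology \<Rightarrow> ('a, real^'n) chart set \<Rightarrow> ('a \<Rightarrow> 'v::euclidean_space bispace set) \<Rightarrow> bool" where
  "nondegenerate_immersion M A F \<longleftrightarrow>
     (let B = (parahyp_atlas :: ('v bispace set, (real^'n) \<times> (real^'n)) chart set) in
      immersion2 M A B F \<and>
      (\<forall>p\<in>topspace M. nondegenerate_form (pullback_form A B F parahyp_metric p)))"

end

theory Submission
  imports Defs
begin

text \<open>
  Differentiating \<open>\<nu>(\<xi>) = 1\<close>, \<open>\<nu>(f\<^sub>*Y) = 0\<close> and \<open>\<nu>(\<xi>\<^sub>*Y) = 0\<close> (the last is the equiaffine condition) gives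
  \<open>\<nu>\<^sub>*X(\<xi>) = 0\<close>, \<open>\<nu>\<^sub>*X(f\<^sub>*Y) = - h(X, Y)\<close> and \<open>\<nu>\<^sub>*X(\<xi>\<^sub>*Y) = - \<nu>(D\<^sub>X \<xi>\<^sub>*Y)\<close>, so that the last two pairings
  are symmetric in \<open>X\<close> and \<open>Y\<close>. With \<open>\<sigma>\<^sub>*X = (- \<xi>\<^sub>*X, \<nu>\<^sub>*X)\<close> and \<open>\<xi>\<^sub>*X = - f\<^sub>*(S X)\<close> this yields
  horizontality, anti-invariance and the induced metric \<open>- \<nu>\<^sub>*Y(\<xi>\<^sub>*X) = - h(S X, Y)\<close>, which is also
  the \<open>\<nu>\<close>-component of \<open>D\<^sub>X \<nu>\<^sub>*Y\<close>.

  For the quotient only injectivity of \<open>d\<pi>\<close> on the horizontal space is needed: along a curve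
  in the hyperquadric on which \<open>d\<pi>\<close> vanishes to first order, the point moves, to first order, along
  its orbit, while horizontal vectors are transverse to the orbit. Hence \<open>d\<pi>(\<sigma>\<^sub>*X)\<close> has the horizontal lift
  \<open>\<sigma>\<^sub>*X\<close>, translated to the chosen representative of the orbit.
\<close>

section \<open>Calculus of smooth maps\<close>

text \<open>Openness turns equality on \<open>S\<close> into equality near each point, so the
  derivatives agree on \<open>S\<close> and the induction passes to the directional
  derivatives.\<close>

lemma Ck_on_cong:
  assumes "open S" "\<And>x. x \<in> S \<Longrightarrow> f x = g x"
  shows "Ck_on k S f \<longleftrightarrow> Ck_on k S g"
  using assms(2)
proof (induction k arbitrary: f g)
  case 0
  then show ?case by (auto intro: continuous_on_cong)
next
  case (Suc k)
  have hd: "(f has_derivative D) (at x) \<longleftrightarrow> (g has_derivative D) (at x)" if "x \<in> S" for x D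
    using has_derivative_transform_within_open[OF _ assms(1) that] Suc.prems by metis
  have d: "frechet_derivative f (at x) = frechet_derivative g (at x)" if "x \<in> S" for x
    unfolding frechet_derivative_def by (simp add: hd that)
  have "Ck_on k S (\<lambda>x. frechet_derivative f (at x) v) = Ck_on k S (\<lambda>x. frechet_derivative g (at x) v)" for v
    by (rule Suc.IH) (simp add: d)
  then show ?case by (simp add: differentiable_def hd)
qed

lemma Ck_on_subset: "Ck_on k S f \<Longrightarrow> T \<subseteq> S \<Longrightarrow> Ck_on k T f"
  by (induction k arbitrary: f) (auto intro: continuous_on_subset)

lemma Ck_on_SucD: "Ck_on (Suc k) S f \<Longrightarrow> Ck_on k S f"
proof (induction k arbitrary: f)
  case 0
  then have "f differentiable_on S"
    by (simp add: differentiable_on_def differentiable_at_withinI)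
  then show ?case by (simp add: differentiable_imp_continuous_on)
next
  case (Suc k)
  then show ?case by (simp only: Ck_on.simps(2)[of "Suc k"] Ck_on.simps(2)[of k]) blast
qed

text \<open>Lets the closure proofs exhibit a derivative by its formula; on an open set this formula
  replaces \<open>frechet_derivative\<close>.\<close>

lemma Ck_on_SucI:
  assumes "open S" "\<And>x. x \<in> S \<Longrightarrow> (f has_derivative f' x) (at x)"
    and "\<And>v. Ck_on k S (\<lambda>x. f' x v)"
  shows "Ck_on (Suc k) S f"
proof -
  have eq: "frechet_derivative f (at x) = f' x" if "x \<in> S" for x
    using assms(2)[OF that] by (rule frechet_derivative_at[symmetric])
  have "Ck_on k S (\<lambda>x. frechet_derivative f (at x) v)" for v
    by (rule iffD2[OF Ck_on_cong[OF assms(1)] assms(3)]) (simp add: eq)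
  with assms(2) show ?thesis by (auto simp: differentiable_def)
qed

lemma Ck_on_has_derivative:
  "Ck_on (Suc k) S f \<Longrightarrow> x \<in> S \<Longrightarrow> (f has_derivative frechet_derivative f (at x)) (at x)"
  by (simp add: frechet_derivative_works[symmetric])

lemma Ck_on_const: "open S \<Longrightarrow> Ck_on k S (\<lambda>x. c)"
  by (induction k arbitrary: c) auto

lemma Ck_on_bounded_linear:
  assumes "bounded_linear g" "open S" "Ck_on k S f"
  shows "Ck_on k S (\<lambda>x. g (f x))"
  using assms(3)
proof (induction k arbitrary: f)
  case 0
  then show ?case using assms(1) by (auto intro: bounded_linear.continuous_on)
next
  case (Suc k)
  show ?case
    by (rule Ck_on_SucI[where f' = "\<lambda>x v. g (frechet_derivative f (at x) v)"])
      (use Suc assms in \<open>auto intro!: bounded_linear.has_derivative[OF assms(1)]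
        intro: Ck_on_has_derivative\<close>)
qed

lemma Ck_on_ident: "open S \<Longrightarrow> Ck_on k S (\<lambda>x. x)"
  by (cases k) (auto simp: Ck_on_const continuous_on_id)

lemma Ck_on_add:
  assumes "open S" "Ck_on k S f" "Ck_on k S g"
  shows "Ck_on k S (\<lambda>x. f x + g x)"
  using assms(2,3)
proof (induction k arbitrary: f g)
  case 0
  then show ?case by (auto intro: continuous_intros)
next
  case (Suc k)
  show ?case
    by (rule Ck_on_SucI[where f' = "\<lambda>x v. frechet_derivative f (at x) v + frechet_derivative g (at x) v"])
      (use Suc assms in \<open>auto intro!: has_derivative_add intro: Ck_on_has_derivative\<close>)
qed

lemma Ck_on_sum:
  assumes "open S" "\<And>i. i \<in> I \<Longrightarrow> Ck_on k S (f i)"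
  shows "Ck_on k S (\<lambda>x. \<Sum>i\<in>I. f i x)"
  using assms(2)
  by (induction I rule: infinite_finite_induct) (auto simp: Ck_on_const Ck_on_add assms(1))

text \<open>The product rule gives two bilinear terms whose factors are C^k, so the induction
  hypothesis for arbitrary \<open>f\<close> and \<open>g\<close> covers each.\<close>

lemma Ck_on_bilinear:
  assumes b: "bounded_bilinear b" and S: "open S" and f: "Ck_on k S f" and g: "Ck_on k S g"
  shows "Ck_on k S (\<lambda>x. b (f x) (g x))"
  using f g
proof (induction k arbitrary: f g)
  case 0
  then show ?case using bounded_bilinear.continuous_on[OF b] by auto
next
  case (Suc k)
  show ?case
    by (rule Ck_on_SucI[where f' = "\<lambda>x v. b (f x) (frechet_derivative g (at x) v)
          + b (frechet_derivative f (at x) v) (g x)"])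
      (use Suc S in \<open>auto intro!: bounded_bilinear.FDERIV[OF b] Ck_on_add Suc.IH
        intro: Ck_on_has_derivative Ck_on_SucD[OF Suc.prems(1)] Ck_on_SucD[OF Suc.prems(2)]\<close>)
qed

text \<open>The derivative is a product built from \<open>inverse (f x)\<close> itself, which is C^k
  by the induction hypothesis.\<close>

lemma Ck_on_inverse:
  fixes f :: "'a::real_normed_vector \<Rightarrow> real"
  assumes S: "open S" and f: "Ck_on k S f" and nz: "\<And>x. x \<in> S \<Longrightarrow> f x \<noteq> 0"
  shows "Ck_on k S (\<lambda>x. inverse (f x))"
  using f
proof (induction k)
  case 0
  then show ?case using nz by (auto intro: continuous_intros)
next
  case (Suc k)
  let ?D = "\<lambda>x. frechet_derivative f (at x)"
  have i: "Ck_on k S (\<lambda>x. inverse (f x))" by (rule Suc.IH[OF Ck_on_SucD[OF Suc.prems]])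
  have "Ck_on k S (\<lambda>x. - 1 * (inverse (f x) * ?D x v * inverse (f x)))" for v
    using Suc.prems by (intro Ck_on_bilinear[OF bounded_bilinear_mult S] Ck_on_const S i) auto
  then show ?case
    by (intro Ck_on_SucI[where f' = "\<lambda>x v. - (inverse (f x) * ?D x v * inverse (f x))"])
      (use Suc S nz in \<open>auto intro!: Deriv.has_derivative_inverse intro: Ck_on_has_derivative\<close>)
qed

lemma Ck_on_prod:
  fixes f :: "'i \<Rightarrow> 'a::real_normed_vector \<Rightarrow> real"
  assumes "open S" "\<And>i. i \<in> I \<Longrightarrow> Ck_on k S (f i)"
  shows "Ck_on k S (\<lambda>x. \<Prod>i\<in>I. f i x)"
  using assms(2)
  by (induction I rule: infinite_finite_induct)
    (auto simp: Ck_on_const assms(1) intro!: Ck_on_bilinear[OF bounded_bilinear_mult])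

lemma Ck_on_Pair:
  assumes "open S" "Ck_on k S f" "Ck_on k S g"
  shows "Ck_on k S (\<lambda>x. (f x, g x))"
proof -
  \<comment> \<open>A pair is the sum of its images under the two linear embeddings.\<close>
  have "Ck_on k S (\<lambda>x. (f x, 0) + (0, g x))"
    by (intro Ck_on_add Ck_on_bounded_linear[OF _ assms(1) assms(2)] Ck_on_bounded_linear[OF _ assms(1) assms(3)] assms(1))
      (auto intro!: bounded_linear_intros)
  then show ?thesis by simp
qed

lemma linear_basis_expansion:
  fixes f :: "'a::euclidean_space \<Rightarrow> 'b::real_vector"
  assumes "linear f"
  shows "f v = (\<Sum>b\<in>Basis. (v \<bullet> b) *\<^sub>R f b)"
proof -
  have "f (\<Sum>b\<in>Basis. (v \<bullet> b) *\<^sub>R b) = (\<Sum>b\<in>Basis. (v \<bullet> b) *\<^sub>R f b)"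
    by (simp only: linear_sum[OF assms] linear_cmul[OF assms])
  then show ?thesis by (simp add: euclidean_representation)
qed

text \<open>\<open>Ck_on\<close> speaks of derivatives in fixed directions, whereas the chain rule
  differentiates \<open>g\<close> in a moving one. Expanding that direction in a basis leaves
  fixed-direction derivatives of \<open>g\<close> composed with \<open>f\<close>, to which the
  induction hypothesis applies.\<close>

lemma Ck_on_compose:
  fixes f :: "'a::real_normed_vector \<Rightarrow> 'b::euclidean_space"
  assumes S: "open S" and T: "open T" and f: "Ck_on k S f" and g: "Ck_on k T g"
    and sub: "\<And>x. x \<in> S \<Longrightarrow> f x \<in> T"
  shows "Ck_on k S (\<lambda>x. g (f x))"
  using f g
proof (induction k arbitrary: g)
  case 0
  then show ?case using sub by (auto intro!: continuous_on_compose2[of T g S f])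
next
  case (Suc k)
  let ?Df = "\<lambda>x. frechet_derivative f (at x)" and ?Dg = "\<lambda>y. frechet_derivative g (at y)"
  have g': "(g has_derivative ?Dg y) (at y)" if "y \<in> T" for y
    using Suc.prems(2) that by (rule Ck_on_has_derivative)
  have f': "(f has_derivative ?Df x) (at x)" if "x \<in> S" for x
    using Suc.prems(1) that by (rule Ck_on_has_derivative)
  have fk: "Ck_on k S f" using Suc.prems(1) by (rule Ck_on_SucD)
  have "Ck_on k S (\<lambda>x. \<Sum>b\<in>Basis. (?Df x v \<bullet> b) *\<^sub>R ?Dg (f x) b)" for v
    using Suc.prems by (intro Ck_on_sum S Ck_on_bilinear[OF bounded_bilinear_scaleR]
        Ck_on_bounded_linear[OF bounded_linear_inner_left] Suc.IH fk) auto
  then have "Ck_on k S (\<lambda>x. ?Dg (f x) (?Df x v))" for v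
    by (rule iffD1[OF Ck_on_cong[OF S], rotated])
      (use g' sub in \<open>auto intro!: linear_basis_expansion[symmetric] has_derivative_linear\<close>)
  then show ?case
    by (intro Ck_on_SucI[where f' = "\<lambda>x v. ?Dg (f x) (?Df x v)"] S)
      (use has_derivative_compose[OF f'] g' sub in blast)+
qed

lemma smooth_on_cong:
  "open S \<Longrightarrow> (\<And>x. x \<in> S \<Longrightarrow> f x = g x) \<Longrightarrow> smooth_on S f \<longleftrightarrow> smooth_on S g"
  unfolding smooth_on_def using Ck_on_cong by blast

lemma smooth_on_subset: "smooth_on S f \<Longrightarrow> T \<subseteq> S \<Longrightarrow> smooth_on T f"
  unfolding smooth_on_def using Ck_on_subset by blast

lemma smooth_on_has_derivative:
  "smooth_on S f \<Longrightarrow> x \<in> S \<Longrightarrow> (f has_derivative frechet_derivative f (at x)) (at x)"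
  unfolding smooth_on_def using Ck_on_has_derivative by blast

lemma smooth_on_continuous_on: "smooth_on S f \<Longrightarrow> continuous_on S f"
  unfolding smooth_on_def using Ck_on.simps(1) by blast

lemma smooth_on_frechet_derivative:
  "smooth_on S f \<Longrightarrow> smooth_on S (\<lambda>x. frechet_derivative f (at x) v)"
  unfolding smooth_on_def using Ck_on.simps(2) by blast

lemma smooth_on_const: "open S \<Longrightarrow> smooth_on S (\<lambda>x. c)"
  by (simp add: smooth_on_def Ck_on_const)

lemma smooth_on_ident: "open S \<Longrightarrow> smooth_on S (\<lambda>x. x)"
  by (simp add: smooth_on_def Ck_on_ident)

lemma smooth_on_bounded_linear:
  "bounded_linear g \<Longrightarrow> open S \<Longrightarrow> smooth_on S f \<Longrightarrow> smooth_on S (\<lambda>x. g (f x))"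
  by (simp add: smooth_on_def Ck_on_bounded_linear)

lemma smooth_on_add:
  "open S \<Longrightarrow> smooth_on S f \<Longrightarrow> smooth_on S g \<Longrightarrow> smooth_on S (\<lambda>x. f x + g x)"
  by (simp add: smooth_on_def Ck_on_add)

lemma smooth_on_sum:
  "open S \<Longrightarrow> (\<And>i. i \<in> I \<Longrightarrow> smooth_on S (f i)) \<Longrightarrow> smooth_on S (\<lambda>x. \<Sum>i\<in>I. f i x)"
  by (simp add: smooth_on_def Ck_on_sum)

lemma smooth_on_bilinear:
  "bounded_bilinear b \<Longrightarrow> open S \<Longrightarrow> smooth_on S f \<Longrightarrow> smooth_on S g \<Longrightarrow>
    smooth_on S (\<lambda>x. b (f x) (g x))"
  by (simp add: smooth_on_def Ck_on_bilinear)

lemma smooth_on_inverse: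
  fixes f :: "'a::real_normed_vector \<Rightarrow> real"
  shows "open S \<Longrightarrow> smooth_on S f \<Longrightarrow> (\<And>x. x \<in> S \<Longrightarrow> f x \<noteq> 0) \<Longrightarrow> smooth_on S (\<lambda>x. inverse (f x))"
  by (simp add: smooth_on_def Ck_on_inverse)

lemma smooth_on_prod:
  fixes f :: "'i \<Rightarrow> 'a::real_normed_vector \<Rightarrow> real"
  shows "open S \<Longrightarrow> (\<And>i. i \<in> I \<Longrightarrow> smooth_on S (f i)) \<Longrightarrow> smooth_on S (\<lambda>x. \<Prod>i\<in>I. f i x)"
  by (simp add: smooth_on_def Ck_on_prod)

lemma smooth_on_Pair:
  "open S \<Longrightarrow> smooth_on S f \<Longrightarrow> smooth_on S g \<Longrightarrow> smooth_on S (\<lambda>x. (f x, g x))"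
  by (simp add: smooth_on_def Ck_on_Pair)

lemma smooth_on_compose:
  fixes f :: "'a::real_normed_vector \<Rightarrow> 'b::euclidean_space"
  shows "open S \<Longrightarrow> open T \<Longrightarrow> smooth_on S f \<Longrightarrow> smooth_on T g \<Longrightarrow> (\<And>x. x \<in> S \<Longrightarrow> f x \<in> T) \<Longrightarrow>
    smooth_on S (\<lambda>x. g (f x))"
  using Ck_on_compose unfolding smooth_on_def by blast

text \<open>As for compositions, the moving direction is expanded in the basis with smooth
  coefficients.\<close>

lemma smooth_on_directional_derivative:
  fixes f :: "'a::euclidean_space \<Rightarrow> 'b::real_normed_vector"
  assumes "open S" "smooth_on S f" "smooth_on S w"
  shows "smooth_on S (\<lambda>x. frechet_derivative f (at x) (w x))"
proof -
  have "smooth_on S (\<lambda>x. \<Sum>b\<in>Basis. (w x \<bullet> b) *\<^sub>R frechet_derivative f (at x) b)"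
    using assms by (intro smooth_on_sum smooth_on_bilinear[OF bounded_bilinear_scaleR]
        smooth_on_bounded_linear[OF bounded_linear_inner_left] smooth_on_frechet_derivative)
  then show ?thesis
    by (rule iffD1[OF smooth_on_cong[OF assms(1)], rotated])
      (use smooth_on_has_derivative[OF assms(2)] in
        \<open>auto intro!: linear_basis_expansion[symmetric] has_derivative_linear\<close>)
qed

section \<open>Symmetry of second derivatives\<close>

lemma has_derivative_along_line:
  fixes f :: "'a::real_normed_vector \<Rightarrow> real"
  assumes "(f has_derivative D) (at (x + a *\<^sub>R u + w))"
  shows "((\<lambda>a. f (x + a *\<^sub>R u + w)) has_derivative (\<lambda>h. h * D u)) (at a)"
proof -
  have "((\<lambda>a. x + a *\<^sub>R u + w) has_derivative (\<lambda>h. h *\<^sub>R u)) (at a)"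
    by (auto intro!: derivative_eq_intros)
  from has_derivative_compose[OF this assms] show ?thesis
    by (simp add: linear_cmul[OF has_derivative_linear[OF assms]])
qed

text \<open>The second difference of \<open>f\<close> in the directions \<open>u\<close>, \<open>v\<close> is symmetric; by two applications of the
  mean value theorem it is a value of the mixed second derivative, in either order.\<close>

lemma second_difference_mvt:
  fixes f :: "'a::real_normed_vector \<Rightarrow> real"
  assumes "Ck_on 2 S f" "t > 0"
    and sub: "\<And>a b. 0 \<le> a \<Longrightarrow> a \<le> t \<Longrightarrow> 0 \<le> b \<Longrightarrow> b \<le> t \<Longrightarrow> x + a *\<^sub>R u + b *\<^sub>R v \<in> S"
  obtains a b where "0 \<le> a" "a \<le> t" "0 \<le> b" "b \<le> t"
    "f (x + t *\<^sub>R u + t *\<^sub>R v) - f (x + t *\<^sub>R u) - f (x + t *\<^sub>R v) + f x =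
      t * t * frechet_derivative (\<lambda>y. frechet_derivative f (at y) u) (at (x + a *\<^sub>R u + b *\<^sub>R v)) v"
proof -
  let ?D = "\<lambda>y. frechet_derivative f (at y) u"
  have C: "Ck_on (Suc (Suc 0)) S f" using assms(1) by (simp add: numeral_2_eq_2)
  have f': "(f has_derivative frechet_derivative f (at y)) (at y)" if "y \<in> S" for y
    using C that by (rule Ck_on_has_derivative)
  have D': "(?D has_derivative frechet_derivative ?D (at y)) (at y)" if "y \<in> S" for y
    using Ck_on_has_derivative[of 0 S ?D y] C that by auto
  \<comment> \<open>The difference of \<open>f\<close> across \<open>t *\<^sub>R v\<close>, as a
    function of the step along \<open>u\<close>; its increment over \<open>{0..t}\<close> is the
    second difference.\<close>
  define g where "g = (\<lambda>a. f (x + a *\<^sub>R u + t *\<^sub>R v) - f (x + a *\<^sub>R u))"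
  have "\<exists>a\<in>{0..t}. g t - g 0 = (t - 0) * (?D (x + a *\<^sub>R u + t *\<^sub>R v) - ?D (x + a *\<^sub>R u))"
  proof (rule mvt_very_simple[where f' = "\<lambda>a h. h * (?D (x + a *\<^sub>R u + t *\<^sub>R v) - ?D (x + a *\<^sub>R u))"])
    fix a :: real assume a: "0 \<le> a" "a \<le> t"
    have S: "x + a *\<^sub>R u + t *\<^sub>R v \<in> S" "x + a *\<^sub>R u \<in> S"
      using a assms(2) sub[of a t] sub[of a 0] by auto
    have "((\<lambda>a. f (x + a *\<^sub>R u + t *\<^sub>R v)) has_derivative (\<lambda>h. h * ?D (x + a *\<^sub>R u + t *\<^sub>R v))) (at a)"
      by (rule has_derivative_along_line[OF f'[OF S(1)]])
    moreover have "((\<lambda>a. f (x + a *\<^sub>R u)) has_derivative (\<lambda>h. h * ?D (x + a *\<^sub>R u))) (at a)"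
      using has_derivative_along_line[of f _ x a u 0] f'[OF S(2)] by simp
    ultimately have "(g has_derivative (\<lambda>h. h * ?D (x + a *\<^sub>R u + t *\<^sub>R v) - h * ?D (x + a *\<^sub>R u))) (at a)"
      unfolding g_def by (rule has_derivative_diff)
    then show "(g has_derivative (\<lambda>h. h * (?D (x + a *\<^sub>R u + t *\<^sub>R v) - ?D (x + a *\<^sub>R u)))) (at a within {0..t})"
      by (simp add: has_derivative_at_withinI right_diff_distrib)
  qed (use assms in simp)
  then obtain a where a: "a \<in> {0..t}" "g t - g 0 = t * (?D (x + a *\<^sub>R u + t *\<^sub>R v) - ?D (x + a *\<^sub>R u))"
    by auto
  define k where "k = (\<lambda>b. ?D (x + a *\<^sub>R u + b *\<^sub>R v))"
  have "\<exists>b\<in>{0..t}. k t - k 0 = (t - 0) * frechet_derivative ?D (at (x + a *\<^sub>R u + b *\<^sub>R v)) v"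
  proof (rule mvt_very_simple[where f' = "\<lambda>b h. h * frechet_derivative ?D (at (x + a *\<^sub>R u + b *\<^sub>R v)) v"])
    fix b :: real assume b: "0 \<le> b" "b \<le> t"
    have S: "x + a *\<^sub>R u + b *\<^sub>R v \<in> S" using a b sub[of a b] by auto
    show "(k has_derivative (\<lambda>h. h * frechet_derivative ?D (at (x + a *\<^sub>R u + b *\<^sub>R v)) v)) (at b within {0..t})"
      unfolding k_def
      using has_derivative_along_line[of ?D _ "x + a *\<^sub>R u" b v 0] D'[OF S]
      by (simp add: has_derivative_at_withinI)
  qed (use assms in simp)
  then obtain b where b: "b \<in> {0..t}" "k t - k 0 = t * frechet_derivative ?D (at (x + a *\<^sub>R u + b *\<^sub>R v)) v"
    by auto
  show ?thesis
  proof (rule that[of a b])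
    show "f (x + t *\<^sub>R u + t *\<^sub>R v) - f (x + t *\<^sub>R u) - f (x + t *\<^sub>R v) + f x =
      t * t * frechet_derivative ?D (at (x + a *\<^sub>R u + b *\<^sub>R v)) v"
      using a b by (simp add: g_def k_def)
  qed (use a b in auto)
qed

text \<open>The second difference over a small parallelogram is \<open>t * t\<close> times either
  mixed derivative, each taken at some point nearby. By continuity both values are close to those at
  \<open>x\<close>.\<close>

lemma frechet_derivative_commute:
  fixes f :: "'a::real_normed_vector \<Rightarrow> real"
  assumes S: "open S" and C: "Ck_on 2 S f" and x: "x \<in> S"
  shows "frechet_derivative (\<lambda>y. frechet_derivative f (at y) u) (at x) v =
    frechet_derivative (\<lambda>y. frechet_derivative f (at y) v) (at x) u"
proof -
  define P where "P u v y = frechet_derivative (\<lambda>y. frechet_derivative f (at y) u) (at y) v" for u v y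
  have cont: "continuous_on S (P u v)" for u v
    using C unfolding P_def by (simp add: numeral_2_eq_2)
  have key: "\<bar>P u v x - P v u x\<bar> \<le> 2 * e" if e: "e > 0" for e
  proof -
    have "\<exists>d>0. \<forall>y. dist y x < d \<longrightarrow> y \<in> S \<and> \<bar>P u v y - P u v x\<bar> < e" for u v
    proof -
      obtain d0 where d0: "d0 > 0" "ball x d0 \<subseteq> S" using S x by (auto simp: open_contains_ball)
      obtain d1 where d1: "d1 > 0" "\<forall>y\<in>S. dist y x < d1 \<longrightarrow> dist (P u v y) (P u v x) < e"
        using cont[of u v] x e by (meson continuous_on_iff)
      have "y \<in> S \<and> \<bar>P u v y - P u v x\<bar> < e" if "dist y x < min d0 d1" for y
      proof -
        have "y \<in> S" using that d0 by (auto simp: dist_commute)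
        then show ?thesis using that d1 by (auto simp: dist_real_def)
      qed
      then show ?thesis using d0 d1 by (intro exI[of _ "min d0 d1"]) auto
    qed
    from this[of u v] this[of v u] obtain d d' where d: "d > 0" "d' > 0"
      "\<And>y. dist y x < d \<Longrightarrow> y \<in> S \<and> \<bar>P u v y - P u v x\<bar> < e"
      "\<And>y. dist y x < d' \<Longrightarrow> y \<in> S \<and> \<bar>P v u y - P v u x\<bar> < e" by blast
    \<comment> \<open>This step keeps the whole parallelogram within \<open>min d d'\<close> of
      \<open>x\<close>; the summand 1 keeps the denominator positive when both directions
      vanish.\<close>
    define t where "t = min d d' / (norm u + norm v + 1)"
    have pos: "norm u + norm v + 1 > 0" by (simp add: add_nonneg_pos)
    have t: "t > 0" using d pos unfolding t_def by (intro divide_pos_pos) auto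
    have nb: "dist (x + a *\<^sub>R u + b *\<^sub>R v) x < min d d'" if "0 \<le> a" "a \<le> t" "0 \<le> b" "b \<le> t" for a b
    proof -
      have "norm (a *\<^sub>R u + b *\<^sub>R v) \<le> a * norm u + b * norm v"
        using that norm_triangle_ineq[of "a *\<^sub>R u" "b *\<^sub>R v"] by simp
      also have "\<dots> \<le> t * norm u + t * norm v"
        using that by (intro add_mono mult_right_mono) auto
      also have "\<dots> < t * (norm u + norm v + 1)" using t by (simp add: algebra_simps)
      also have "\<dots> = min d d'" using pos by (simp add: t_def)
      finally show ?thesis by (simp add: dist_norm algebra_simps)
    qed
    obtain a b where 1: "0 \<le> a" "a \<le> t" "0 \<le> b" "b \<le> t"
      "f (x + t *\<^sub>R u + t *\<^sub>R v) - f (x + t *\<^sub>R u) - f (x + t *\<^sub>R v) + f x =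
        t * t * P u v (x + a *\<^sub>R u + b *\<^sub>R v)"
      unfolding P_def using nb d by (elim second_difference_mvt[OF C t, of x u v, rotated 1]) auto
    obtain a' b' where 2: "0 \<le> a'" "a' \<le> t" "0 \<le> b'" "b' \<le> t"
      "f (x + t *\<^sub>R v + t *\<^sub>R u) - f (x + t *\<^sub>R v) - f (x + t *\<^sub>R u) + f x =
        t * t * P v u (x + a' *\<^sub>R v + b' *\<^sub>R u)"
    proof -
      have "x + a *\<^sub>R v + b *\<^sub>R u \<in> S" if "0 \<le> a" "a \<le> t" "0 \<le> b" "b \<le> t" for a b
        using d(3) nb[of b a] that by (auto simp: algebra_simps)
      then show ?thesis
        using that unfolding P_def by (elim second_difference_mvt[OF C t, of x v u, rotated 1]) auto
    qed
    have "t * t * P u v (x + a *\<^sub>R u + b *\<^sub>R v) = t * t * P v u (x + a' *\<^sub>R v + b' *\<^sub>R u)"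
      using 1(5) 2(5) by (simp add: algebra_simps)
    then have "P u v (x + a *\<^sub>R u + b *\<^sub>R v) = P v u (x + a' *\<^sub>R v + b' *\<^sub>R u)"
      using t by simp
    moreover have "\<bar>P u v (x + a *\<^sub>R u + b *\<^sub>R v) - P u v x\<bar> < e" using d(3) nb 1 by auto
    moreover have "\<bar>P v u (x + a' *\<^sub>R v + b' *\<^sub>R u) - P v u x\<bar> < e"
      using d(4) nb[of b' a'] 2 by (auto simp: algebra_simps)
    ultimately show ?thesis by linarith
  qed
  have "P u v x = P v u x"
  proof (rule ccontr)
    assume "P u v x \<noteq> P v u x"
    \<comment> \<open>A quarter of the supposed gap makes the bound half of the gap.\<close>
    then show False using key[of "\<bar>P u v x - P v u x\<bar> / 4"] by auto
  qed
  then show ?thesis by (simp add: P_def)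
qed

section \<open>Charts and differentials\<close>

locale smooth_mfd =
  fixes M :: "'a topology" and A :: "('a, 'e::euclidean_space) chart set"
  assumes mfd: "smooth_manifold M A"
begin

lemma is_chart: "c \<in> A \<Longrightarrow> is_chart M c"
  and topspace_eq: "topspace M = (\<Union>c\<in>A. fst c)"
  and smooth_transition:
    "c \<in> A \<Longrightarrow> d \<in> A \<Longrightarrow> smooth_on (snd c ` (fst c \<inter> fst d)) (snd d \<circ> chart_inv c)"
  using mfd by (auto simp: smooth_manifold_def)

lemma openin_chart_domain: "c \<in> A \<Longrightarrow> openin M (fst c)"
  and open_chart_range: "c \<in> A \<Longrightarrow> open (snd c ` fst c)"
  and homeomorphic_chart:
    "c \<in> A \<Longrightarrow> homeomorphic_map (subtopology M (fst c)) (top_of_set (snd c ` fst c)) (snd c)"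
  using is_chart by (auto simp: is_chart_def)

lemma chart_domain_subset: "c \<in> A \<Longrightarrow> fst c \<subseteq> topspace M"
  by (simp add: openin_chart_domain openin_subset)

lemma chart_domain_point: "c \<in> A \<Longrightarrow> q \<in> fst c \<Longrightarrow> q \<in> topspace M"
  using chart_domain_subset by blast

lemma inj_on_chart: "c \<in> A \<Longrightarrow> inj_on (snd c) (fst c)"
  using homeomorphic_imp_injective_map[OF homeomorphic_chart, of c]
  using chart_domain_subset[of c] by (simp add: Int_absorb1)

lemma chart_inv_chart [simp]: "c \<in> A \<Longrightarrow> q \<in> fst c \<Longrightarrow> chart_inv c (snd c q) = q"
  by (simp add: chart_inv_def inj_on_chart)

lemma open_chart_image:
  assumes "c \<in> A" "openin M U"
  shows "open (snd c ` (fst c \<inter> U))"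
proof -
  have "openin (subtopology M (fst c)) (fst c \<inter> U)"
    using assms by (metis openin_subtopology_Int2)
  then have "openin (top_of_set (snd c ` fst c)) (snd c ` (fst c \<inter> U))"
    using homeomorphic_imp_open_map[OF homeomorphic_chart[OF assms(1)]] by (simp add: open_map_def)
  then show ?thesis using open_chart_range[OF assms(1)] by (rule openin_open_trans)
qed

lemma openin_chart_preimage:
  assumes "c \<in> A" "open V"
  shows "openin M {q \<in> fst c. snd c q \<in> V}"
proof -
  have "openin (subtopology M (fst c)) {q \<in> topspace (subtopology M (fst c)). snd c q \<in> snd c ` fst c \<inter> V}"
    by (rule openin_continuous_map_preimage[OF homeomorphic_imp_continuous_map[OF homeomorphic_chart[OF assms(1)]]])
      (use assms(2) in \<open>auto intro: openin_open_Int\<close>)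
  moreover have "{q \<in> topspace (subtopology M (fst c)). snd c q \<in> snd c ` fst c \<inter> V} = {q \<in> fst c. snd c q \<in> V}"
    using chart_domain_subset[OF assms(1)] by auto
  ultimately show ?thesis
    using openin_trans_full[OF _ openin_chart_domain[OF assms(1)]] by metis
qed

lemma chart_at_mem: "p \<in> topspace M \<Longrightarrow> chart_at A p \<in> A"
  and mem_chart_at: "p \<in> topspace M \<Longrightarrow> p \<in> fst (chart_at A p)"
proof -
  assume "p \<in> topspace M"
  then have "\<exists>c. c \<in> A \<and> p \<in> fst c" using topspace_eq by auto
  from someI_ex[OF this] show "chart_at A p \<in> A" "p \<in> fst (chart_at A p)"
    by (simp_all add: chart_at_def)
qed

section \<open>Differentials computed in arbitrary charts\<close>

lemma smooth_mapD: "smooth_map A g \<Longrightarrow> c \<in> A \<Longrightarrow> smooth_on (snd c ` fst c) (g \<circ> chart_inv c)"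
  by (simp add: smooth_map_def)

lemma smooth_map_has_derivative:
  assumes "smooth_map A g" "c \<in> A" "q \<in> fst c"
  shows "((g \<circ> chart_inv c) has_derivative frechet_derivative (g \<circ> chart_inv c) (at (snd c q))) (at (snd c q))"
  using smooth_on_has_derivative[OF smooth_mapD[OF assms(1,2)]] assms(3) by blast

lemma smooth_map_has_derivative_mdiff:
  assumes "smooth_map A g" "p \<in> topspace M"
  shows "((g \<circ> chart_inv (chart_at A p)) has_derivative mdiff A g p) (at (snd (chart_at A p) p))"
  unfolding mdiff_def by (rule smooth_map_has_derivative) (use assms chart_at_mem mem_chart_at in auto)

lemma linear_mdiff: "smooth_map A g \<Longrightarrow> p \<in> topspace M \<Longrightarrow> linear (mdiff A g p)"
  using smooth_map_has_derivative_mdiff has_derivative_linear by blast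

text \<open>Tangent vectors at \<open>q\<close> are written in the preferred chart; the chain rule
  through its transition to \<open>c\<close> lets the derivative be computed in \<open>c\<close>
  instead.\<close>

lemma mdiff_eq_chart_derivative:
  assumes c: "c \<in> A" "q \<in> fst c"
    and g: "((g \<circ> chart_inv c) has_derivative G) (at (snd c q))"
  shows "mdiff A g q X = G (mdiff A (snd c) q X)"
proof -
  let ?d = "chart_at A q"
  have q: "q \<in> topspace M" using c by (rule chart_domain_point)
  note d = chart_at_mem[OF q] mem_chart_at[OF q]
  let ?W = "snd ?d ` (fst ?d \<inter> fst c)"
  have W: "open ?W" "snd ?d q \<in> ?W"
    using open_chart_image[OF d(1) openin_chart_domain[OF c(1)]] c d by auto
  have "((snd c \<circ> chart_inv ?d) has_derivative mdiff A (snd c) q) (at (snd ?d q))"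
    unfolding mdiff_def by (rule smooth_on_has_derivative[OF smooth_transition[OF d(1) c(1)] W(2)])
  moreover have "((g \<circ> chart_inv c) has_derivative G) (at ((snd c \<circ> chart_inv ?d) (snd ?d q)))"
    using g c d by simp
  ultimately have "((g \<circ> chart_inv c) \<circ> (snd c \<circ> chart_inv ?d) has_derivative G \<circ> mdiff A (snd c) q) (at (snd ?d q))"
    by (rule diff_chain_at)
  then have "((g \<circ> chart_inv ?d) has_derivative G \<circ> mdiff A (snd c) q) (at (snd ?d q))"
    by (rule has_derivative_transform_within_open[OF _ W]) (use c d in auto)
  from frechet_derivative_at[OF this] show ?thesis by (simp add: mdiff_def fun_eq_iff)
qed

lemma mdiff_smooth_map_chart:
  "smooth_map A g \<Longrightarrow> c \<in> A \<Longrightarrow> q \<in> fst c \<Longrightarrow>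
    mdiff A g q X = frechet_derivative (g \<circ> chart_inv c) (at (snd c q)) (mdiff A (snd c) q X)"
  by (intro mdiff_eq_chart_derivative smooth_map_has_derivative)

lemma mdiff_chart_at:
  assumes p: "p \<in> topspace M"
  shows "mdiff A (snd (chart_at A p)) p = id"
proof -
  let ?c = "chart_at A p"
  note c = chart_at_mem[OF p] mem_chart_at[OF p]
  have "((snd ?c \<circ> chart_inv ?c) has_derivative id) (at (snd ?c p))"
    by (rule has_derivative_transform_within_open[of id id, OF _ open_chart_range[OF c(1)]])
      (use c in \<open>auto simp: id_def\<close>)
  from frechet_derivative_at[OF this] show ?thesis by (simp add: mdiff_def)
qed

lemma transition_has_derivative:
  assumes "c \<in> A" "d \<in> A" "q \<in> fst c" "q \<in> fst d"
  shows "((snd d \<circ> chart_inv c) has_derivative frechet_derivative (snd d \<circ> chart_inv c) (at (snd c q))) (at (snd c q))"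
  using smooth_on_has_derivative[OF smooth_transition[OF assms(1,2)]] assms(3,4) by blast

text \<open>The coordinate field of \<open>c\<close> with constant components, written in the
  preferred charts as all tangent vectors are. Those charts may jump from point to point, so its
  smoothness shows only in components.\<close>

definition chart_vector :: "('a, 'e) chart \<Rightarrow> 'a \<Rightarrow> 'e \<Rightarrow> 'e" where
  "chart_vector c q = frechet_derivative (snd (chart_at A q) \<circ> chart_inv c) (at (snd c q))"

text \<open>The chain rule makes \<open>chart_vector c q\<close> a left inverse of
  \<open>mdiff A (snd c) q\<close>; in finite dimension it is then a right inverse too.\<close>

lemma mdiff_chart_vector:
  assumes c: "c \<in> A" "q \<in> fst c"
  shows "mdiff A (snd c) q (chart_vector c q e) = e"
proof -
  let ?d = "chart_at A q" and ?T = "mdiff A (snd c) q" and ?T' = "chart_vector c q"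
  have q: "q \<in> topspace M" using c by (rule chart_domain_point)
  note d = chart_at_mem[OF q] mem_chart_at[OF q]
  have T': "((snd ?d \<circ> chart_inv c) has_derivative ?T') (at (snd c q))"
    unfolding chart_vector_def by (rule transition_has_derivative) (use c d in auto)
  have "linear ?T'" using T' by (rule has_derivative_linear)
  moreover have "linear ?T"
    unfolding mdiff_def
    by (rule has_derivative_linear[OF transition_has_derivative]) (use c d in auto)
  moreover have "?T' (?T X) = X" for X
    using mdiff_eq_chart_derivative[OF c T', of X] mdiff_chart_at[OF q] by simp
  ultimately have "?T \<circ> ?T' = id" using linear_inverse_left[of ?T' ?T] by (auto simp: fun_eq_iff)
  then show ?thesis by (simp add: fun_eq_iff)
qed

lemma chart_derivative_eq_mdiff:
  assumes "smooth_map A g" "c \<in> A" "q \<in> fst c"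
  shows "frechet_derivative (g \<circ> chart_inv c) (at (snd c q)) e = mdiff A g q (chart_vector c q e)"
  using mdiff_smooth_map_chart[OF assms] mdiff_chart_vector[OF assms(2,3)] by simp

lemma chart_vector_chart_at: "p \<in> topspace M \<Longrightarrow> chart_vector (chart_at A p) p Y = Y"
  using mdiff_chart_at[of p] by (simp add: chart_vector_def mdiff_def fun_eq_iff)

text \<open>In a chart \<open>d\<close> the preferred charts cancel: the components are the
  derivative of the transition from \<open>c\<close> to \<open>d\<close> in the fixed direction
  \<open>Y\<close>.\<close>

lemma smooth_chart_vector:
  assumes c: "c \<in> A"
  shows "smooth_vector_field M A (fst c) (\<lambda>q. chart_vector c q Y)"
proof -
  let ?Y = "\<lambda>q. chart_vector c q Y"
  have "smooth_on (snd d ` (fst d \<inter> fst c)) ((\<lambda>q. mdiff A (snd d) q (?Y q)) \<circ> chart_inv d)"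
    if d: "d \<in> A" for d
  proof -
    let ?S = "snd d ` (fst d \<inter> fst c)" and ?D = "\<lambda>x. frechet_derivative (snd d \<circ> chart_inv c) (at x) Y"
    have S: "open ?S" by (rule open_chart_image[OF d openin_chart_domain[OF c]])
    have "smooth_on ?S (\<lambda>x. ?D ((snd c \<circ> chart_inv d) x))"
      by (rule smooth_on_compose[OF S _ smooth_transition[OF d c]
            smooth_on_frechet_derivative[OF smooth_transition[OF c d]]])
        (use d c in \<open>auto intro: open_chart_image openin_chart_domain\<close>)
    then show ?thesis
    proof (rule iffD1[OF smooth_on_cong[OF S], rotated])
      fix x assume "x \<in> ?S"
      then obtain q where q: "q \<in> fst d" "q \<in> fst c" "x = snd d q" by auto
      have "mdiff A (snd d) q (?Y q) = frechet_derivative (snd d \<circ> chart_inv c) (at (snd c q)) (mdiff A (snd c) q (?Y q))"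
        by (rule mdiff_eq_chart_derivative[OF c q(2) transition_has_derivative]) (use c d q in auto)
      then show "?D ((snd c \<circ> chart_inv d) x) = ((\<lambda>q. mdiff A (snd d) q (?Y q)) \<circ> chart_inv d) x"
        using q d c by (simp add: mdiff_chart_vector)
    qed
  qed
  then show ?thesis by (simp add: smooth_vector_field_def openin_chart_domain c)
qed

lemma smooth_on_mdiff_vector_field:
  assumes g: "smooth_map A g" and c: "c \<in> A" and Y: "smooth_vector_field M A U Y"
  shows "smooth_on (snd c ` (fst c \<inter> U)) ((\<lambda>q. mdiff A g q (Y q)) \<circ> chart_inv c)"
proof -
  let ?S = "snd c ` (fst c \<inter> U)"
  have S: "open ?S" using Y by (simp add: smooth_vector_field_def open_chart_image c)
  have "smooth_on ?S (\<lambda>x. frechet_derivative (g \<circ> chart_inv c) (at x) (((\<lambda>q. mdiff A (snd c) q (Y q)) \<circ> chart_inv c) x))"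
    by (rule smooth_on_directional_derivative[OF S smooth_on_subset[OF smooth_mapD[OF g c]]])
      (use Y c in \<open>simp_all add: smooth_vector_field_def image_mono o_def\<close>)
  then show ?thesis
    by (rule iffD1[OF smooth_on_cong[OF S], rotated]) (use c mdiff_smooth_map_chart[OF g c] in auto)
qed

lemma mdiff_vector_field_differentiable:
  assumes "smooth_map A g" "smooth_vector_field M A U Y" "p \<in> U"
  shows "((\<lambda>q. mdiff A g q (Y q)) \<circ> chart_inv (chart_at A p)) differentiable (at (snd (chart_at A p) p))"
proof -
  have p: "p \<in> topspace M"
    using assms(2,3) openin_subset by (auto simp: smooth_vector_field_def)
  show ?thesis
    unfolding differentiable_def
    by (rule exI, rule smooth_on_has_derivative[OF smooth_on_mdiff_vector_field[OF assms(1) chart_at_mem[OF p] assms(2)]])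
      (use mem_chart_at[OF p] assms(3) in auto)
qed

lemma smooth_map_differentiable:
  assumes "smooth_map A g" "p \<in> topspace M"
  shows "(g \<circ> chart_inv (chart_at A p)) differentiable (at (snd (chart_at A p) p))"
  using smooth_map_has_derivative_mdiff[OF assms] by (auto simp: differentiable_def)

section \<open>Differentiating dual pairings and commuting second differentials\<close>

text \<open>The product rule for a constant function. The hypothesis is differentiability in the
  chart at \<open>p\<close>, because \<open>g\<close> or \<open>k\<close> may be the derivative of a
  map along a field given only on \<open>U\<close>.\<close>

lemma mdiff_constant_pairing:
  fixes g :: "'a \<Rightarrow> ('b::real_normed_vector \<Rightarrow>\<^sub>L real)"
  assumes p: "openin M U" "p \<in> U"
    and g: "(g \<circ> chart_inv (chart_at A p)) differentiable (at (snd (chart_at A p) p))"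
    and k: "(k \<circ> chart_inv (chart_at A p)) differentiable (at (snd (chart_at A p) p))"
    and const: "\<And>q. q \<in> U \<Longrightarrow> blinfun_apply (g q) (k q) = C"
  shows "blinfun_apply (g p) (mdiff A k p X) + blinfun_apply (mdiff A g p X) (k p) = 0"
proof -
  let ?c = "chart_at A p" and ?x = "snd (chart_at A p) p"
  have pM: "p \<in> topspace M" using p openin_subset by blast
  note c = chart_at_mem[OF pM] mem_chart_at[OF pM]
  let ?S = "snd ?c ` (fst ?c \<inter> U)"
  have S: "open ?S" "?x \<in> ?S" using open_chart_image[OF c(1) p(1)] c p by auto
  have "((\<lambda>x. blinfun_apply ((g \<circ> chart_inv ?c) x) ((k \<circ> chart_inv ?c) x)) has_derivative
      (\<lambda>X. blinfun_apply ((g \<circ> chart_inv ?c) ?x) (mdiff A k p X) +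
        blinfun_apply (mdiff A g p X) ((k \<circ> chart_inv ?c) ?x))) (at ?x)"
    unfolding mdiff_def
    by (rule bounded_bilinear.FDERIV[OF bounded_bilinear_blinfun_apply
          iffD1[OF frechet_derivative_works g] iffD1[OF frechet_derivative_works k]])
  moreover have "((\<lambda>x. blinfun_apply ((g \<circ> chart_inv ?c) x) ((k \<circ> chart_inv ?c) x)) has_derivative (\<lambda>X. 0)) (at ?x)"
    by (rule has_derivative_transform_within_open[OF has_derivative_const S])
      (use const c in \<open>auto intro!: const[symmetric]\<close>)
  ultimately have "(\<lambda>X. blinfun_apply ((g \<circ> chart_inv ?c) ?x) (mdiff A k p X) +
        blinfun_apply (mdiff A g p X) ((k \<circ> chart_inv ?c) ?x)) = (\<lambda>X. 0)"
    by (rule has_derivative_unique)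
  then show ?thesis using c by (simp add: fun_eq_iff)
qed

text \<open>Along coordinate fields of the preferred chart, iterated differentials are iterated
  derivatives in that chart; pairing with \<open>\<phi>\<close> reduces symmetry to real-valued
  functions.\<close>

lemma mdiff_mdiff_commute:
  fixes \<phi> :: "'b::real_normed_vector \<Rightarrow>\<^sub>L real"
  assumes g: "smooth_map A g" and p: "p \<in> topspace M"
  shows "blinfun_apply \<phi> (mdiff A (\<lambda>q. mdiff A g q (chart_vector (chart_at A p) q Y)) p X) =
    blinfun_apply \<phi> (mdiff A (\<lambda>q. mdiff A g q (chart_vector (chart_at A p) q X)) p Y)"
proof -
  let ?c = "chart_at A p"
  note c = chart_at_mem[OF p] mem_chart_at[OF p]
  let ?S = "snd ?c ` fst ?c" and ?x = "snd ?c p" and ?g = "g \<circ> chart_inv ?c"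
  let ?G = "\<lambda>x. blinfun_apply \<phi> (?g x)"
  have S: "open ?S" "?x \<in> ?S" using open_chart_range[OF c(1)] c by auto
  note sm = smooth_mapD[OF g c(1)]
  have dG: "frechet_derivative ?G (at x) Z = blinfun_apply \<phi> (frechet_derivative ?g (at x) Z)"
    if "x \<in> ?S" for x Z
    using frechet_derivative_at[OF bounded_linear.has_derivative[OF blinfun.bounded_linear_right
          smooth_on_has_derivative[OF sm that]], of \<phi>] by (simp add: fun_eq_iff)
  have *: "blinfun_apply \<phi> (mdiff A (\<lambda>q. mdiff A g q (chart_vector ?c q Z)) p W) =
    frechet_derivative (\<lambda>x. frechet_derivative ?G (at x) Z) (at ?x) W" for Z W
  proof -
    let ?H = "(\<lambda>q. mdiff A g q (chart_vector ?c q Z)) \<circ> chart_inv ?c"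
    have "(?H has_derivative mdiff A (\<lambda>q. mdiff A g q (chart_vector ?c q Z)) p) (at ?x)"
      unfolding mdiff_def[of A "\<lambda>q. mdiff A g q (chart_vector ?c q Z)"]
      using mdiff_vector_field_differentiable[OF g smooth_chart_vector[OF c(1)] c(2), of Z]
      by (simp add: frechet_derivative_works[symmetric])
    from bounded_linear.has_derivative[OF blinfun.bounded_linear_right this, of \<phi>]
    have "((\<lambda>x. frechet_derivative ?G (at x) Z) has_derivative
      (\<lambda>W. blinfun_apply \<phi> (mdiff A (\<lambda>q. mdiff A g q (chart_vector ?c q Z)) p W))) (at ?x)"
      by (rule has_derivative_transform_within_open[OF _ S])
        (use dG chart_derivative_eq_mdiff[OF g c(1)] c in auto)
    from frechet_derivative_at[OF this] show ?thesis by (simp add: fun_eq_iff)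
  qed
  have "smooth_on ?S ?G" by (rule smooth_on_bounded_linear[OF blinfun.bounded_linear_right S(1) sm])
  then have "Ck_on 2 ?S ?G" by (simp add: smooth_on_def)
  from frechet_derivative_commute[OF S(1) this S(2)] show ?thesis by (simp only: *)
qed

lemma openin_smooth_map_preimage:
  assumes g: "smooth_map A g" and c: "c \<in> A" and V: "open V"
  shows "openin M {q \<in> fst c. g q \<in> V}"
proof -
  have "open ((g \<circ> chart_inv c) -` V \<inter> snd c ` fst c)"
    using continuous_open_preimage[OF smooth_on_continuous_on[OF smooth_mapD[OF g c]] open_chart_range[OF c] V]
    by (simp add: Int_commute)
  note * = openin_chart_preimage[OF c this]
  have "{q \<in> fst c. snd c q \<in> (g \<circ> chart_inv c) -` V \<inter> snd c ` fst c} = {q \<in> fst c. g q \<in> V}"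
  proof -
    have "snd c q \<in> (g \<circ> chart_inv c) -` V \<inter> snd c ` fst c \<longleftrightarrow> g q \<in> V" if "q \<in> fst c" for q
      using that c by simp
    then show ?thesis by blast
  qed
  with * show ?thesis by metis
qed

lemma smooth_map_bounded_linear:
  assumes "bounded_linear L" "smooth_map A g"
  shows "smooth_map A (\<lambda>q. L (g q))"
  unfolding smooth_map_def
proof
  fix c assume c: "c \<in> A"
  from smooth_on_bounded_linear[OF assms(1) open_chart_range[OF c] smooth_mapD[OF assms(2) c]]
  show "smooth_on (snd c ` fst c) ((\<lambda>q. L (g q)) \<circ> chart_inv c)" by (simp add: o_def)
qed

lemma mdiff_bounded_linear:
  assumes "bounded_linear L" "smooth_map A g" "p \<in> topspace M"
  shows "mdiff A (\<lambda>q. L (g q)) p X = L (mdiff A g p X)"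
proof -
  from bounded_linear.has_derivative[OF assms(1) smooth_map_has_derivative_mdiff[OF assms(2,3)]]
  have "(((\<lambda>q. L (g q)) \<circ> chart_inv (chart_at A p)) has_derivative (\<lambda>X. L (mdiff A g p X))) (at (snd (chart_at A p) p))"
    by (simp add: o_def)
  from frechet_derivative_at[OF this] show ?thesis by (simp add: mdiff_def fun_eq_iff)
qed

lemma smooth_map_Pair:
  assumes "smooth_map A f" "smooth_map A g"
  shows "smooth_map A (\<lambda>q. (f q, g q))"
  unfolding smooth_map_def
proof
  fix c assume c: "c \<in> A"
  from smooth_on_Pair[OF open_chart_range[OF c] smooth_mapD[OF assms(1) c] smooth_mapD[OF assms(2) c]]
  show "smooth_on (snd c ` fst c) ((\<lambda>q. (f q, g q)) \<circ> chart_inv c)" by (simp add: o_def)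
qed

lemma mdiff_Pair:
  assumes "smooth_map A f" "smooth_map A g" "p \<in> topspace M"
  shows "mdiff A (\<lambda>q. (f q, g q)) p X = (mdiff A f p X, mdiff A g p X)"
proof -
  from has_derivative_Pair[OF smooth_map_has_derivative_mdiff[OF assms(1,3)] smooth_map_has_derivative_mdiff[OF assms(2,3)]]
  have "(((\<lambda>q. (f q, g q)) \<circ> chart_inv (chart_at A p)) has_derivative (\<lambda>X. (mdiff A f p X, mdiff A g p X))) (at (snd (chart_at A p) p))"
    by (simp add: o_def)
  from frechet_derivative_at[OF this] show ?thesis by (simp add: mdiff_def fun_eq_iff)
qed

end

section \<open>Equiaffine immersions and their conormal maps\<close>

lemma linear_blinfun_apply: "linear (blinfun_apply \<alpha>)"
  and linear_blinfun_eval: "linear (\<lambda>\<alpha>. blinfun_apply \<alpha> v)"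
  by (auto intro: bounded_linear.linear blinfun.bounded_linear_right blinfun.bounded_linear_left)

text \<open>A functional that is 1 on \<open>\<eta> p\<close> and kills tangent vectors reads off
  the coefficient, so the definite description has one witness. For \<open>f\<close> it will be the
  conormal, for the conormal map evaluation at \<open>\<xi> p\<close>.\<close>

lemma transversal_part_eqI:
  assumes "w = mdiff A g p X + t *\<^sub>R \<eta> p"
    and "linear \<phi>" "\<phi> (\<eta> p) = (1::real)" "\<And>Y. \<phi> (mdiff A g p Y) = 0"
  shows "transversal_part A g \<eta> p w = t"
proof -
  have "s = t" if "w = mdiff A g p Y + s *\<^sub>R \<eta> p" for s Y
  proof -
    have "\<phi> (mdiff A g p Y + s *\<^sub>R \<eta> p) = s" "\<phi> (mdiff A g p X + t *\<^sub>R \<eta> p) = t"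
      using assms(3,4) by (simp_all add: linear_add[OF assms(2)] linear_cmul[OF assms(2)])
    then show ?thesis using that assms(1) by metis
  qed
  then show ?thesis unfolding transversal_part_def using assms(1) by blast
qed

lemma tangential_part_eqI:
  assumes "w = mdiff A g p X + t *\<^sub>R \<eta> p" and "inj (mdiff A g p)"
    and "linear \<phi>" "\<phi> (\<eta> p) = (1::real)" "\<And>Y. \<phi> (mdiff A g p Y) = 0"
  shows "tangential_part A g \<eta> p w = X"
proof -
  have "Y = X" if Y: "w = mdiff A g p Y + s *\<^sub>R \<eta> p" for s Y
  proof -
    have "transversal_part A g \<eta> p w = s"
      by (rule transversal_part_eqI[where \<phi> = \<phi>], rule Y) (use assms(3-5) in auto)
    moreover have "transversal_part A g \<eta> p w = t"
      by (rule transversal_part_eqI[where \<phi> = \<phi>], rule assms(1)) (use assms(3-5) in auto)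
    ultimately have "s = t" by simp
    then have "mdiff A g p Y = mdiff A g p X" using Y assms(1) by simp
    then show ?thesis using assms(2) by (simp add: inj_eq)
  qed
  then show ?thesis unfolding tangential_part_def using assms(1) by blast
qed

section \<open>Smooth dependence of solutions of linear systems\<close>

lemma smooth_on_det:
  fixes B :: "'a::real_normed_vector \<Rightarrow> real^'m^'m"
  assumes "open S" "\<And>i j. smooth_on S (\<lambda>x. B x $ i $ j)"
  shows "smooth_on S (\<lambda>x. det (B x))"
  unfolding det_def
  by (intro smooth_on_sum smooth_on_bilinear[OF bounded_bilinear_mult] smooth_on_const smooth_on_prod assms)

text \<open>Cramer's rule: each component is a quotient of determinants with smooth entries.\<close>

lemma smooth_on_matrix_solution:
  fixes B :: "'a::real_normed_vector \<Rightarrow> real^'m^'m"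
  assumes S: "open S" and B: "\<And>i j. smooth_on S (\<lambda>x. B x $ i $ j)"
    and det: "\<And>x. x \<in> S \<Longrightarrow> det (B x) \<noteq> 0" and a: "\<And>x. x \<in> S \<Longrightarrow> B x *v a x = b"
  shows "smooth_on S (\<lambda>x. a x $ k)"
proof -
  have "smooth_on S (\<lambda>x. det (\<chi> i j. if j = k then b $ i else B x $ i $ j) * inverse (det (B x)))"
  proof (intro smooth_on_bilinear[OF bounded_bilinear_mult S] smooth_on_inverse smooth_on_det S B det)
    fix i j
    show "smooth_on S (\<lambda>x. (\<chi> i j. if j = k then b $ i else B x $ i $ j) $ i $ j)"
      using B S by (cases "j = k") (simp_all add: smooth_on_const)
  qed
  then show ?thesis
  proof (rule iffD1[OF smooth_on_cong[OF S], rotated])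
    fix x assume x: "x \<in> S"
    from iffD1[OF cramer[OF det[OF x]] a[OF x]]
    show "det (\<chi> i j. if j = k then b $ i else B x $ i $ j) * inverse (det (B x)) = a x $ k"
      by (metis (no_types, lifting) divide_inverse vec_lambda_beta)
  qed
qed

section \<open>The affine decomposition, the conormal and the shape operator\<close>

locale equiaffine_mfd = smooth_mfd M A
  for M :: "'a topology" and A :: "('a, real^'n) chart set" +
  fixes f \<xi> :: "'a \<Rightarrow> real^'m"
  assumes dim: "CARD('m) = CARD('n) + 1"
    and equiaffine: "equiaffine_immersion M A f \<xi>"
    and nondegenerate: "nondegenerate_affine M A f \<xi>"
    and det_shape: "\<And>p. p \<in> topspace M \<Longrightarrow> det (matrix (affine_shape A f \<xi> p)) \<noteq> 0"
begin

abbreviation \<nu> where "\<nu> \<equiv> conormal A f \<xi>"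
abbreviation h where "h \<equiv> affine_metric M A f \<xi>"
abbreviation shape where "shape \<equiv> affine_shape A f \<xi>"

lemma smooth_f: "smooth_map A f" and smooth_\<xi>: "smooth_map A \<xi>"
  and inj_f: "p \<in> topspace M \<Longrightarrow> inj (mdiff A f p)"
  using equiaffine by (auto simp: equiaffine_immersion_def affine_immersion_def immersion_def)

lemma affine_decomposition:
  assumes "p \<in> topspace M"
  obtains X t where "w = mdiff A f p X + t *\<^sub>R \<xi> p"
proof -
  have "w \<in> {u + v |u v. u \<in> range (mdiff A f p) \<and> v \<in> span {\<xi> p}}"
    using equiaffine assms by (auto simp: equiaffine_immersion_def affine_immersion_def)
  then show ?thesis using that by (auto simp: span_singleton)
qed

text \<open>Different coefficients would put a nonzero multiple of \<open>\<xi> p\<close> into the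
  tangent image, forcing \<open>\<xi> p = 0\<close> by the trivial intersection. The tangent image
  would then be the whole space, against its dimension.\<close>

lemma affine_decomposition_unique:
  assumes p: "p \<in> topspace M" and eq: "mdiff A f p X + t *\<^sub>R \<xi> p = mdiff A f p Y + s *\<^sub>R \<xi> p"
  shows "t = s"
proof (rule ccontr)
  assume ts: "t \<noteq> s"
  note lin = linear_mdiff[OF smooth_f p]
  have "mdiff A f p (X - Y) = (s - t) *\<^sub>R \<xi> p"
    using eq by (simp add: linear_diff[OF lin] algebra_simps)
  then have "(s - t) *\<^sub>R \<xi> p \<in> range (mdiff A f p) \<inter> span {\<xi> p}"
    by (metis IntI rangeI span_base span_mul singletonI)
  moreover have "range (mdiff A f p) \<inter> span {\<xi> p} = {0}"
    using equiaffine p by (simp add: equiaffine_immersion_def affine_immersion_def)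
  ultimately have "(s - t) *\<^sub>R \<xi> p = 0" by blast
  then have \<xi>: "\<xi> p = 0" using ts by simp
  have "w \<in> range (mdiff A f p)" for w
    using \<xi> by (rule_tac affine_decomposition[OF p, of w]) auto
  then have "dim (range (mdiff A f p)) = CARD('m)"
    by (metis DIM_cart DIM_real UNIV_eq_I dim_UNIV mult.right_neutral)
  moreover have "dim (range (mdiff A f p)) \<le> CARD('n)"
    using dim_image_le[OF lin, of UNIV] by simp
  ultimately show False using dim by simp
qed

text \<open>The transversal coefficient is the functional sought: uniqueness makes it linear, finite
  dimension makes it bounded.\<close>

lemma conormal_ex:
  assumes p: "p \<in> topspace M"
  shows "\<exists>\<alpha> :: (real^'m) \<Rightarrow>\<^sub>L real. blinfun_apply \<alpha> (\<xi> p) = 1 \<and> (\<forall>X. blinfun_apply \<alpha> (mdiff A f p X) = 0)"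
proof -
  note lin = linear_mdiff[OF smooth_f p]
  define \<phi> where "\<phi> w = (SOME t. \<exists>X. w = mdiff A f p X + t *\<^sub>R \<xi> p)" for w
  have \<phi>: "\<phi> w = t" if "w = mdiff A f p X + t *\<^sub>R \<xi> p" for w X t
    unfolding \<phi>_def by (rule some_equality) (use that affine_decomposition_unique[OF p] in blast)+
  have "linear \<phi>"
  proof (rule linearI)
    fix v w :: "real^'m" and r :: real
    obtain X t where v: "v = mdiff A f p X + t *\<^sub>R \<xi> p" by (rule affine_decomposition[OF p])
    obtain Y s where w: "w = mdiff A f p Y + s *\<^sub>R \<xi> p" by (rule affine_decomposition[OF p])
    have "v + w = mdiff A f p (X + Y) + (t + s) *\<^sub>R \<xi> p" "r *\<^sub>R v = mdiff A f p (r *\<^sub>R X) + (r * t) *\<^sub>R \<xi> p"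
      by (simp_all add: v w linear_add[OF lin] linear_cmul[OF lin] algebra_simps)
    from this[THEN \<phi>] show "\<phi> (v + w) = \<phi> v + \<phi> w" "\<phi> (r *\<^sub>R v) = r *\<^sub>R \<phi> v"
      by (simp_all add: \<phi>[OF v] \<phi>[OF w])
  qed
  then have "blinfun_apply (Blinfun \<phi>) w = \<phi> w" for w
    by (simp add: bounded_linear_Blinfun_apply linear_conv_bounded_linear)
  moreover have "\<phi> (\<xi> p) = 1" by (rule \<phi>[of _ 0]) (simp add: linear_0[OF lin])
  moreover have "\<phi> (mdiff A f p X) = 0" for X by (rule \<phi>[of _ X]) simp
  ultimately show ?thesis by (intro exI[of _ "Blinfun \<phi>"]) simp
qed

lemma conormal_unique:
  fixes \<alpha> \<beta> :: "(real^'m) \<Rightarrow>\<^sub>L real"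
  assumes p: "p \<in> topspace M"
    and "blinfun_apply \<alpha> (\<xi> p) = 1" "\<And>X. blinfun_apply \<alpha> (mdiff A f p X) = 0"
    and "blinfun_apply \<beta> (\<xi> p) = 1" "\<And>X. blinfun_apply \<beta> (mdiff A f p X) = 0"
  shows "\<alpha> = \<beta>"
proof (rule blinfun_eqI)
  fix w
  obtain X t where w: "w = mdiff A f p X + t *\<^sub>R \<xi> p" by (rule affine_decomposition[OF p])
  show "blinfun_apply \<alpha> w = blinfun_apply \<beta> w"
    unfolding w using assms(2-) by (simp add: blinfun.bilinear_simps)
qed

lemma conormal_\<xi>: "p \<in> topspace M \<Longrightarrow> blinfun_apply (\<nu> p) (\<xi> p) = 1"
  and conormal_f: "p \<in> topspace M \<Longrightarrow> blinfun_apply (\<nu> p) (mdiff A f p X) = 0"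
proof -
  assume p: "p \<in> topspace M"
  have "\<exists>!\<alpha> :: (real^'m) \<Rightarrow>\<^sub>L real. blinfun_apply \<alpha> (\<xi> p) = 1 \<and> (\<forall>X. blinfun_apply \<alpha> (mdiff A f p X) = 0)"
    using conormal_ex[OF p] conormal_unique[OF p] by blast
  from theI'[OF this]
  show "blinfun_apply (\<nu> p) (\<xi> p) = 1" "blinfun_apply (\<nu> p) (mdiff A f p X) = 0"
    by (simp_all add: conormal_def)
qed

lemma transversal_part_f:
  assumes p: "p \<in> topspace M"
  shows "transversal_part A f \<xi> p w = blinfun_apply (\<nu> p) w"
proof -
  obtain X t where w: "w = mdiff A f p X + t *\<^sub>R \<xi> p" by (rule affine_decomposition[OF p])
  have "transversal_part A f \<xi> p w = t"
    by (rule transversal_part_eqI[where \<phi> = "blinfun_apply (\<nu> p)"], rule w)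
      (use p in \<open>simp_all add: conormal_\<xi> conormal_f linear_blinfun_apply\<close>)
  then show ?thesis by (simp add: w blinfun.bilinear_simps conormal_\<xi>[OF p] conormal_f[OF p])
qed

text \<open>The Weingarten formula, whose transversal term vanishes by the equiaffine
  condition.\<close>

lemma mdiff_\<xi>:
  assumes p: "p \<in> topspace M"
  shows "mdiff A \<xi> p X = - mdiff A f p (shape p X)"
proof -
  obtain Z t where w: "mdiff A \<xi> p X = mdiff A f p Z + t *\<^sub>R \<xi> p" by (rule affine_decomposition[OF p])
  have "transversal_form A f \<xi> p X = t"
    unfolding transversal_form_def
    by (rule transversal_part_eqI[where \<phi> = "blinfun_apply (\<nu> p)"], rule w)
      (use p in \<open>simp_all add: conormal_\<xi> conormal_f linear_blinfun_apply\<close>)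
  then have "t = 0" using equiaffine p by (simp add: equiaffine_immersion_def)
  moreover have "shape p X = - Z"
    unfolding affine_shape_def neg_equal_iff_equal
    by (rule tangential_part_eqI[where \<phi> = "blinfun_apply (\<nu> p)"], rule w)
      (use p in \<open>simp_all add: inj_f conormal_\<xi> conormal_f linear_blinfun_apply\<close>)
  ultimately show ?thesis using w by (simp add: linear_neg[OF linear_mdiff[OF smooth_f p]])
qed

lemma conormal_mdiff_\<xi>: "p \<in> topspace M \<Longrightarrow> blinfun_apply (\<nu> p) (mdiff A \<xi> p X) = 0"
  by (simp add: mdiff_\<xi> conormal_f blinfun.minus_right)

text \<open>The shape operator inherits linearity from \<open>\<xi>\<^sub>*\<close> through the
  injective \<open>f\<^sub>*\<close>, so a nonzero determinant means injectivity.\<close>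

lemma inj_shape:
  assumes p: "p \<in> topspace M"
  shows "inj (shape p)"
proof -
  note linf = linear_mdiff[OF smooth_f p] and lin\<xi> = linear_mdiff[OF smooth_\<xi> p]
  have S: "mdiff A f p (shape p X) = - mdiff A \<xi> p X" for X using mdiff_\<xi>[OF p] by simp
  have "linear (shape p)"
    by (rule linearI; rule injD[OF inj_f[OF p]])
      (simp_all add: S linear_add[OF linf] linear_cmul[OF linf] linear_add[OF lin\<xi>] linear_cmul[OF lin\<xi>])
  then show ?thesis using det_shape[OF p] det_nz_iff_inj by blast
qed

text \<open>In a chart the conormal solves a linear system whose rows are \<open>\<xi>\<close> and
  the coordinate derivatives of \<open>f\<close>. These rows span the space, so Cramer's rule
  applies.\<close>

lemma smooth_conormal: "smooth_map A \<nu>"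
  unfolding smooth_map_def
proof
  fix c assume c: "c \<in> A"
  let ?S = "snd c ` fst c"
  have S: "open ?S" by (rule open_chart_range[OF c])
  \<comment> \<open>The index \<open>m0\<close> is reserved for the row \<open>\<xi>\<close>; the
    remaining ones are matched with the coordinate directions.\<close>
  obtain m0 :: 'm where True by simp
  have "card (UNIV - {m0}) = card (UNIV :: 'n set)" using dim by (simp add: card_Diff_singleton)
  then obtain b where b: "bij_betw b (UNIV - {m0}) (UNIV :: 'n set)"
    by (metis finite finite_same_card_bij)
  define a where "a x = (\<chi> j. blinfun_apply (\<nu> (chart_inv c x)) (axis j 1))" for x
  define B where "B x = (\<chi> i. if i = m0 then \<xi> (chart_inv c x)
      else frechet_derivative (f \<circ> chart_inv c) (at x) (axis (b i) 1))" for x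
  have inner_a: "u \<bullet> a x = blinfun_apply (\<nu> (chart_inv c x)) u" for u x
  proof -
    have "blinfun_apply (\<nu> (chart_inv c x)) u = (\<Sum>i\<in>UNIV. u $ i * a x $ i)"
      using linear_basis_expansion[OF linear_blinfun_apply, of "\<nu> (chart_inv c x)" u]
      by (simp add: Basis_vec_def a_def inner_axis sum.UNION_disjoint axis_eq_axis)
    then show ?thesis by (simp add: inner_vec_def)
  qed
  have point: "chart_inv c x \<in> topspace M" "chart_inv c x \<in> fst c" "snd c (chart_inv c x) = x" if "x \<in> ?S" for x
    using that c chart_domain_point[OF c] by auto
  have derivative_f: "frechet_derivative (f \<circ> chart_inv c) (at x) e = mdiff A f (chart_inv c x) (chart_vector c (chart_inv c x) e)"
    if "x \<in> ?S" for x e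
    using chart_derivative_eq_mdiff[OF smooth_f c point(2)[OF that]] point(3)[OF that] by simp
  have "det (B x) \<noteq> 0" if x: "x \<in> ?S" for x
  proof -
    let ?q = "chart_inv c x" and ?F = "frechet_derivative (f \<circ> chart_inv c) (at x)"
    have linF: "linear ?F"
      by (rule has_derivative_linear[OF smooth_on_has_derivative[OF smooth_mapD[OF smooth_f c] x]])
    \<comment> \<open>A kernel vector is orthogonal to \<open>\<xi>\<close> and to all tangent
      vectors, hence to everything.\<close>
    have "y = 0" if y: "B x *v y = 0" for y
    proof -
      have row: "B x $ i \<bullet> y = 0" for i using y by (metis matrix_vector_mul_component zero_index)
      have \<xi>y: "\<xi> ?q \<bullet> y = 0" using row[of m0] by (simp add: B_def)
      have "?F (axis k 1) \<bullet> y = 0" for k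
      proof -
        obtain i where "i \<noteq> m0" "b i = k" using bij_betw_imp_surj_on[OF b] by (metis DiffE UNIV_I imageE singletonI)
        then show ?thesis using row[of i] by (simp add: B_def)
      qed
      then have "?F e \<bullet> y = 0" for e
        by (subst linear_basis_expansion[OF linF]) (auto simp: inner_sum_left Basis_vec_def intro!: sum.neutral)
      then have "mdiff A f ?q X \<bullet> y = 0" for X
        using mdiff_smooth_map_chart[OF smooth_f c point(2)[OF x]] point(3)[OF x] by simp
      then have "w \<bullet> y = 0" for w
        using affine_decomposition[OF point(1)[OF x], of w] \<xi>y by (metis add.right_neutral inner_add_left inner_scaleR_left mult_zero_right)
      then show "y = 0" by (metis inner_eq_zero_iff)
    qed
    then show ?thesis
      using matrix_left_invertible_ker[of "B x"] invertible_left_inverse[of "B x"] invertible_det_nz[of "B x"] by blast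
  qed
  \<comment> \<open>The defining conditions of the conormal, as a system with constant right-hand
    side.\<close>
  moreover have "B x *v a x = axis m0 1" if x: "x \<in> ?S" for x
  proof -
    have "(B x *v a x) $ i = axis m0 1 $ i" for i
      unfolding matrix_vector_mul_component inner_a
      using derivative_f[OF x] conormal_f conormal_\<xi> point(1)[OF x]
      by (cases "i = m0") (simp_all add: B_def axis_def)
    then show ?thesis by (simp add: vec_eq_iff)
  qed
  moreover have "smooth_on ?S (\<lambda>x. B x $ i $ j)" for i j
  proof (cases "i = m0")
    case True
    then show ?thesis
      using smooth_on_bounded_linear[OF bounded_linear_vec_nth S smooth_mapD[OF smooth_\<xi> c], of j]
      by (simp add: B_def o_def)
  next
    case False
    then show ?thesis
      using smooth_on_bounded_linear[OF bounded_linear_vec_nth[of j] S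
          smooth_on_frechet_derivative[OF smooth_mapD[OF smooth_f c]]]
      by (simp add: B_def)
  qed
  ultimately have "smooth_on ?S (\<lambda>x. a x $ k)" for k
    using smooth_on_matrix_solution[OF S] by metis
  \<comment> \<open>The functional is rebuilt from its components in the dual basis.\<close>
  then have "smooth_on ?S (\<lambda>x. \<Sum>k\<in>UNIV. a x $ k *\<^sub>R blinfun_inner_left (axis k 1))"
    by (intro smooth_on_sum S smooth_on_bilinear[OF bounded_bilinear_scaleR] smooth_on_const)
  then show "smooth_on ?S (\<nu> \<circ> chart_inv c)"
  proof (rule iffD1[OF smooth_on_cong[OF S], rotated])
    fix x assume "x \<in> ?S"
    show "(\<Sum>k\<in>UNIV. a x $ k *\<^sub>R blinfun_inner_left (axis k 1)) = (\<nu> \<circ> chart_inv c) x"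
    proof (rule blinfun_eqI)
      fix u
      show "blinfun_apply (\<Sum>k\<in>UNIV. a x $ k *\<^sub>R blinfun_inner_left (axis k 1)) u =
        blinfun_apply ((\<nu> \<circ> chart_inv c) x) u"
        by (simp add: blinfun.sum_left blinfun.scaleR_left inner_a[symmetric] inner_axis) (simp add: inner_vec_def mult.commute)
    qed
  qed
qed

section \<open>Derivatives of the conormal identities\<close>

text \<open>Differentiating \<open>\<nu>(\<xi>) = 1\<close> leaves this term alone, since
  \<open>\<nu>(\<xi>\<^sub>*X) = 0\<close>.\<close>

lemma mdiff_conormal_\<xi>:
  assumes p: "p \<in> topspace M"
  shows "blinfun_apply (mdiff A \<nu> p X) (\<xi> p) = 0"
  using mdiff_constant_pairing[OF openin_topspace p smooth_map_differentiable[OF smooth_conormal p]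
      smooth_map_differentiable[OF smooth_\<xi> p], of 1 X] conormal_\<xi> conormal_mdiff_\<xi>[OF p]
  by simp

text \<open>Differentiates \<open>\<nu>(g\<^sub>*Y') = 0\<close>. It serves for \<open>f\<close>,
  and by the equiaffine condition also for \<open>\<xi>\<close>, in the role of
  \<open>g\<close>.\<close>

lemma conormal_second_derivative:
  assumes g: "smooth_map A g" and \<nu>_g: "\<And>q X. q \<in> topspace M \<Longrightarrow> blinfun_apply (\<nu> q) (mdiff A g q X) = 0"
    and Y: "smooth_vector_field M A U Y'" "p \<in> U"
  shows "blinfun_apply (\<nu> p) (mdiff A (\<lambda>q. mdiff A g q (Y' q)) p X) =
    - blinfun_apply (mdiff A \<nu> p X) (mdiff A g p (Y' p))"
proof -
  have U: "openin M U" using Y by (simp add: smooth_vector_field_def)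
  then have M: "U \<subseteq> topspace M" by (rule openin_subset)
  then have p: "p \<in> topspace M" using Y by auto
  show ?thesis
    using mdiff_constant_pairing[OF U Y(2) smooth_map_differentiable[OF smooth_conormal p]
      mdiff_vector_field_differentiable[OF g Y], of 0 X] \<nu>_g M by force
qed

text \<open>Both sides are values of the conormal on second derivatives of \<open>g\<close>, which commute.\<close>

lemma conormal_pairing_commute:
  assumes g: "smooth_map A g" and \<nu>_g: "\<And>q X. q \<in> topspace M \<Longrightarrow> blinfun_apply (\<nu> q) (mdiff A g q X) = 0"
    and p: "p \<in> topspace M"
  shows "blinfun_apply (mdiff A \<nu> p X) (mdiff A g p Y) = blinfun_apply (mdiff A \<nu> p Y) (mdiff A g p X)"
proof -
  note c = chart_at_mem[OF p] mem_chart_at[OF p]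
  note D = conormal_second_derivative[OF g \<nu>_g smooth_chart_vector[OF c(1)] c(2), unfolded chart_vector_chart_at[OF p]]
  show ?thesis using mdiff_mdiff_commute[OF g p, of "\<nu> p" Y X] D[of Y X] D[of X Y] by simp
qed

text \<open>Differentiates \<open>\<nu>\<^sub>*Y'(\<xi>) = 0\<close>.\<close>

lemma second_derivative_conormal_\<xi>:
  assumes Y: "smooth_vector_field M A U Y'" "p \<in> U"
  shows "blinfun_apply (mdiff A (\<lambda>q. mdiff A \<nu> q (Y' q)) p X) (\<xi> p) =
    - blinfun_apply (mdiff A \<nu> p (Y' p)) (mdiff A \<xi> p X)"
proof -
  have U: "openin M U" using Y by (simp add: smooth_vector_field_def)
  then have M: "U \<subseteq> topspace M" by (rule openin_subset)
  then have p: "p \<in> topspace M" using Y by auto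
  show ?thesis
    using mdiff_constant_pairing[OF U Y(2) mdiff_vector_field_differentiable[OF smooth_conormal Y]
      smooth_map_differentiable[OF smooth_\<xi> p], of 0 X] mdiff_conormal_\<xi> M by force
qed

section \<open>Affine metrics of the immersion and of its conormal map\<close>

text \<open>The coordinate field of the preferred chart extends \<open>Y\<close>, so the condition
  on all extensions is not vacuous and determines the value.\<close>

lemma affine_metric_eqI:
  assumes p: "p \<in> topspace M"
    and "\<And>U Y'. smooth_vector_field M A U Y' \<Longrightarrow> p \<in> U \<Longrightarrow> Y' p = Y \<Longrightarrow>
      transversal_part A g \<eta> p (mdiff A (\<lambda>q. mdiff A g q (Y' q)) p X) = t"
  shows "affine_metric M A g \<eta> p X Y = t"
proof -
  note c = chart_at_mem[OF p] mem_chart_at[OF p]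
  note field = smooth_chart_vector[OF c(1), of Y] c(2) chart_vector_chart_at[OF p, of Y]
  show ?thesis
    unfolding affine_metric_def
  proof (rule the_equality)
    show "\<forall>U Y'. p \<in> U \<and> smooth_vector_field M A U Y' \<and> Y' p = Y \<longrightarrow>
      t = transversal_part A g \<eta> p (mdiff A (\<lambda>q. mdiff A g q (Y' q)) p X)"
      using assms(2) by auto
    fix s
    assume s: "\<forall>U Y'. p \<in> U \<and> smooth_vector_field M A U Y' \<and> Y' p = Y \<longrightarrow>
      s = transversal_part A g \<eta> p (mdiff A (\<lambda>q. mdiff A g q (Y' q)) p X)"
    have "s = transversal_part A g \<eta> p (mdiff A (\<lambda>q. mdiff A g q (chart_vector (chart_at A p) q Y)) p X)"
      using s field by blast
    also have "\<dots> = t" by (rule assms(2)[OF field])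
    finally show "s = t" .
  qed
qed

lemma affine_metric_f:
  assumes p: "p \<in> topspace M"
  shows "h p X Y = - blinfun_apply (mdiff A \<nu> p X) (mdiff A f p Y)"
  by (rule affine_metric_eqI[OF p]) (simp add: transversal_part_f[OF p] conormal_second_derivative[OF smooth_f conormal_f])

text \<open>A vector killed by \<open>\<nu>\<^sub>*\<close> is \<open>h\<close>-orthogonal to
  everything, so non-degeneracy makes the conormal map an immersion.\<close>

lemma mdiff_conormal_eq_0:
  assumes p: "p \<in> topspace M" and "mdiff A \<nu> p X = 0"
  shows "X = 0"
  using nondegenerate p affine_metric_f[OF p, of X] assms(2)
  by (auto simp: nondegenerate_affine_def nondegenerate_form_def)

text \<open>Transversality of the conormal to its own image, by counting dimensions: evaluation at
  \<open>\<xi> p\<close> recovers \<open>t\<close>, injectivity of \<open>\<nu>\<^sub>*\<close>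
  recovers \<open>X\<close>, and the pairs \<open>(X, t)\<close> have the dimension of the
  dual.\<close>

lemma conormal_decomposition:
  fixes \<alpha> :: "(real^'m) \<Rightarrow>\<^sub>L real"
  assumes p: "p \<in> topspace M"
  obtains X t where "\<alpha> = mdiff A \<nu> p X + t *\<^sub>R \<nu> p"
proof -
  note lin = linear_mdiff[OF smooth_conormal p]
  \<comment> \<open>Functionals are replaced by their coordinate vectors, so that the count takes
    place in \<open>real^'m\<close>.\<close>
  define \<Phi> :: "(real^'n) \<times> real \<Rightarrow> real^'m"
    where "\<Phi> z = (\<chi> j. blinfun_apply (mdiff A \<nu> p (fst z) + snd z *\<^sub>R \<nu> p) (axis j 1))" for z
  have lin\<Phi>: "linear \<Phi>"
    by (rule linearI) (simp_all add: \<Phi>_def vec_eq_iff linear_add[OF lin] linear_cmul[OF lin]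
        blinfun.bilinear_simps algebra_simps)
  have ext: "\<alpha> = \<beta>" if "\<And>j. blinfun_apply \<alpha> (axis j 1) = blinfun_apply \<beta> (axis j 1)"
    for \<alpha> \<beta> :: "(real^'m) \<Rightarrow>\<^sub>L real"
    by (rule blinfun_euclidean_eqI) (use that in \<open>auto simp: Basis_vec_def\<close>)
  have "inj \<Phi>"
    unfolding linear_injective_0[OF lin\<Phi>]
  proof (intro allI impI)
    fix z assume "\<Phi> z = 0"
    then have 0: "mdiff A \<nu> p (fst z) + snd z *\<^sub>R \<nu> p = 0"
      by (intro ext) (simp add: \<Phi>_def vec_eq_iff)
    have "snd z = blinfun_apply (mdiff A \<nu> p (fst z) + snd z *\<^sub>R \<nu> p) (\<xi> p)"
      by (simp add: blinfun.bilinear_simps mdiff_conormal_\<xi>[OF p] conormal_\<xi>[OF p])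
    then have "snd z = 0" by (simp add: 0)
    moreover from this have "fst z = 0" using 0 mdiff_conormal_eq_0[OF p] by simp
    ultimately show "z = 0" by (simp add: prod_eq_iff)
  qed
  then have "dim (range \<Phi>) = DIM(real^'m)"
    using dim_image_eq[OF lin\<Phi>, of UNIV] dim by simp
  then have "range \<Phi> = UNIV"
    using linear_subspace_image[OF lin\<Phi> subspace_UNIV] by (metis dim_eq_full span_eq_iff)
  then obtain z where "\<Phi> z = (\<chi> j. blinfun_apply \<alpha> (axis j 1))" by (metis surjD)
  then have "\<alpha> = mdiff A \<nu> p (fst z) + snd z *\<^sub>R \<nu> p"
    by (intro ext) (simp add: \<Phi>_def vec_eq_iff)
  then show ?thesis by (rule that)
qed

text \<open>Evaluation at \<open>\<xi> p\<close> kills the image of \<open>\<nu>\<^sub>*\<close> and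
  so picks out the \<open>\<nu>\<close>-component of the second derivative.\<close>

lemma affine_metric_conormal:
  assumes p: "p \<in> topspace M"
  shows "affine_metric M A \<nu> \<nu> p X Y = - blinfun_apply (mdiff A \<nu> p Y) (mdiff A \<xi> p X)"
proof (rule affine_metric_eqI[OF p])
  fix U Y' assume Y: "smooth_vector_field M A U Y'" "p \<in> U" "Y' p = Y"
  let ?D = "mdiff A (\<lambda>q. mdiff A \<nu> q (Y' q)) p X"
  obtain Z t where w: "?D = mdiff A \<nu> p Z + t *\<^sub>R \<nu> p" by (rule conormal_decomposition[OF p])
  have "transversal_part A \<nu> \<nu> p ?D = t"
    by (rule transversal_part_eqI[where \<phi> = "\<lambda>\<alpha>. blinfun_apply \<alpha> (\<xi> p)"], rule w)
      (simp_all add: conormal_\<xi>[OF p] mdiff_conormal_\<xi>[OF p] linear_blinfun_eval)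
  moreover have "blinfun_apply ?D (\<xi> p) = t"
    by (simp add: w blinfun.bilinear_simps conormal_\<xi>[OF p] mdiff_conormal_\<xi>[OF p])
  ultimately show "transversal_part A \<nu> \<nu> p ?D = - blinfun_apply (mdiff A \<nu> p Y) (mdiff A \<xi> p X)"
    using second_derivative_conormal_\<xi>[OF Y(1,2), of X] Y(3) by simp
qed

section \<open>The map into the pseudohyperbolic space\<close>

abbreviation \<sigma> where "\<sigma> \<equiv> sigma_minus A f \<xi>"

lemma \<sigma>_eq: "\<sigma> = (\<lambda>q. (- \<xi> q, \<nu> q))"
  by (simp add: sigma_minus_def fun_eq_iff)

lemma smooth_\<sigma>: "smooth_map A \<sigma>"
  unfolding \<sigma>_eq
  by (intro smooth_map_Pair smooth_conormal smooth_map_bounded_linear[OF _ smooth_\<xi>]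
      bounded_linear_minus bounded_linear_ident)

lemma mdiff_\<sigma>:
  assumes p: "p \<in> topspace M"
  shows "mdiff A \<sigma> p X = (- mdiff A \<xi> p X, mdiff A \<nu> p X)"
proof -
  have m: "bounded_linear (uminus :: real^'m \<Rightarrow> real^'m)" by (intro bounded_linear_minus bounded_linear_ident)
  show ?thesis
    unfolding \<sigma>_eq mdiff_Pair[OF smooth_map_bounded_linear[OF m smooth_\<xi>] smooth_conormal p]
      mdiff_bounded_linear[OF m smooth_\<xi> p] ..
qed

lemma fst_\<sigma>: "fst (\<sigma> p) = - \<xi> p" and snd_\<sigma>: "snd (\<sigma> p) = \<nu> p"
  by (simp_all add: \<sigma>_eq)

lemma \<sigma>_pseudohyp: "p \<in> topspace M \<Longrightarrow> \<sigma> p \<in> pseudohyp"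
  by (simp add: fst_\<sigma> snd_\<sigma> pseudohyp_def conormal_\<xi> blinfun.minus_right)

lemma \<sigma>_horizontal: "p \<in> topspace M \<Longrightarrow> mdiff A \<sigma> p X \<in> horizontal (\<sigma> p)"
  by (simp add: horizontal_iff mdiff_\<sigma> fst_\<sigma> snd_\<sigma> conormal_mdiff_\<xi> mdiff_conormal_\<xi> blinfun.minus_right)

lemma inj_\<sigma>:
  assumes p: "p \<in> topspace M"
  shows "inj (mdiff A \<sigma> p)"
  unfolding linear_injective_0[OF linear_mdiff[OF smooth_\<sigma> p]]
  using mdiff_conormal_eq_0[OF p] by (simp add: mdiff_\<sigma>[OF p] zero_prod_def)

lemma immersion_\<sigma>: "immersion_into_pseudohyp M A \<sigma>"
  using smooth_\<sigma> inj_\<sigma> \<sigma>_pseudohyp by (auto simp: immersion_into_pseudohyp_def immersion_def)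

text \<open>\<open>phi\<close> flips the covector part, so the metric becomes half the difference of
  \<open>\<nu>\<^sub>*X(\<xi>\<^sub>*Y)\<close> and \<open>\<nu>\<^sub>*Y(\<xi>\<^sub>*X)\<close>,
  which agree.\<close>

lemma neutral_metric_phi_\<sigma>:
  assumes p: "p \<in> topspace M"
  shows "neutral_metric (phi (\<sigma> p) (mdiff A \<sigma> p X)) (mdiff A \<sigma> p Y) = 0"
  using conormal_pairing_commute[OF smooth_\<xi> conormal_mdiff_\<xi> p, of X Y]
  unfolding phi_horizontal[OF \<sigma>_horizontal[OF p]]
  by (simp add: mdiff_\<sigma>[OF p] neutral_metric_def blinfun.bilinear_simps)

text \<open>The same two equal pairings enter with equal signs here, which absorbs the factor one
  half.\<close>

lemma induced_metric_\<sigma>: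
  assumes p: "p \<in> topspace M"
  shows "induced_metric A \<sigma> p X Y = - blinfun_apply (mdiff A \<nu> p Y) (mdiff A \<xi> p X)"
  using conormal_pairing_commute[OF smooth_\<xi> conormal_mdiff_\<xi> p, of X Y]
  by (simp add: induced_metric_def mdiff_\<sigma>[OF p] neutral_metric_def blinfun.bilinear_simps)

text \<open>Insert \<open>\<xi>\<^sub>*X = - f\<^sub>*(S X)\<close> and exchange \<open>S X\<close>
  and \<open>Y\<close> in the pairing for \<open>f\<close>.\<close>

lemma induced_metric_\<sigma>_dual_form:
  assumes p: "p \<in> topspace M"
  shows "induced_metric A \<sigma> p X Y = - dual_form M A f \<xi> p X Y"
  using conormal_pairing_commute[OF smooth_f conormal_f p, of "shape p X" Y]
  by (simp add: dual_form_def affine_metric_f[OF p] induced_metric_\<sigma>[OF p] mdiff_\<xi>[OF p, of X] blinfun.minus_right)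

text \<open>The metric is \<open>- h(S X, Y)\<close>: non-degeneracy of \<open>h\<close> gives
  \<open>S X = 0\<close>, and injectivity of \<open>S\<close> finishes.\<close>

lemma nondegenerate_induced_metric_\<sigma>:
  assumes p: "p \<in> topspace M"
  shows "nondegenerate_form (induced_metric A \<sigma> p)"
  unfolding nondegenerate_form_def
proof (intro allI impI)
  fix X assume "\<forall>Y. induced_metric A \<sigma> p X Y = 0"
  then have "h p (shape p X) Y = 0" for Y
    using induced_metric_\<sigma>_dual_form[OF p, of X] by (simp add: dual_form_def)
  then have "shape p X = 0"
    using nondegenerate p by (simp add: nondegenerate_affine_def nondegenerate_form_def)
  moreover have "shape p 0 = 0"
    using mdiff_\<xi>[OF p, of 0] linear_0[OF linear_mdiff[OF smooth_\<xi> p]] linear_0[OF linear_mdiff[OF smooth_f p]]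
      injD[OF inj_f[OF p], of "shape p 0" 0] by simp
  ultimately show "X = 0" using injD[OF inj_shape[OF p], of X 0] by simp
qed

end

section \<open>The quotient by the action of the reals\<close>

lemma fst_act [simp]: "fst (act t z) = exp t *\<^sub>R fst z"
  and snd_act [simp]: "snd (act t z) = exp (- t) *\<^sub>R snd z"
  by (simp_all add: act_def)

lemma bounded_linear_act: "bounded_linear (act t)"
  unfolding act_def
  by (intro bounded_linear_Pair bounded_linear_scaleR_right[THEN bounded_linear_compose]
      bounded_linear_fst bounded_linear_snd)

lemma act_act: "act t (act s z) = act (t + s) z"
  by (simp add: prod_eq_iff exp_add exp_diff exp_minus divide_inverse)

lemma act_0: "act 0 z = z"
  by (simp add: prod_eq_iff)

lemma act_pseudohyp: "z \<in> pseudohyp \<Longrightarrow> act t z \<in> pseudohyp"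
  by (simp add: pseudohyp_def blinfun.bilinear_simps exp_minus)

lemma neutral_metric_act: "neutral_metric (act t X) (act t Y) = neutral_metric X Y"
  by (simp add: neutral_metric_def blinfun.bilinear_simps exp_minus field_simps)

lemma neutral_metric_commute: "neutral_metric X Y = neutral_metric Y X"
  by (simp add: neutral_metric_def)

lemma horizontal_act: "X \<in> horizontal z \<Longrightarrow> act t X \<in> horizontal (act t z)"
  by (simp add: horizontal_iff blinfun.bilinear_simps)

lemma mem_pi_minus: "z \<in> pi_minus z"
  unfolding pi_minus_def using act_0 by (metis rangeI)

lemma pi_minus_act: "pi_minus (act t z) = pi_minus z"
proof -
  have "act s z \<in> range (\<lambda>s. act s (act t z))" for s
    by (rule range_eqI[of _ _ "s - t"]) (simp add: act_act)
  then show ?thesis by (auto simp: pi_minus_def act_act)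
qed

lemma pi_minus_eqD: "pi_minus y = pi_minus z \<Longrightarrow> \<exists>t. y = act t z"
  using mem_pi_minus[of y] by (auto simp: pi_minus_def)

text \<open>
  A chart of the quotient around the orbit of \<open>(v0, \<alpha>0)\<close>: every orbit with \<open>\<alpha>0 v < 0\<close> contains exactly
  one point with \<open>\<alpha>0 v = - 1\<close>, and that point is determined by the component of \<open>v\<close> in the
  kernel of \<open>\<alpha>0\<close>, which is parametrised by \<open>L\<close>, and the restriction of \<open>\<alpha>\<close> to this kernel.
\<close>

locale quotient_slice =
  fixes v0 :: "'v::euclidean_space" and \<alpha>0 :: "'v \<Rightarrow>\<^sub>L real"
    and L :: "'e::euclidean_space \<Rightarrow> 'v" and L' :: "'v \<Rightarrow> 'e"
  assumes \<alpha>0_v0: "blinfun_apply \<alpha>0 v0 = - 1"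
    and linear_L: "linear L" and linear_L': "linear L'"
    and \<alpha>0_L: "\<And>x. blinfun_apply \<alpha>0 (L x) = 0"
    and L'_L: "\<And>x. L' (L x) = x"
    and L_L': "\<And>v. L (L' v) = v + blinfun_apply \<alpha>0 v *\<^sub>R v0"
begin

definition slice_domain :: "'v bispace set" where
  "slice_domain = {z. blinfun_apply \<alpha>0 (fst z) < 0}"

text \<open>With \<open>l = - \<alpha>0 v\<close>, the action at time \<open>- ln l\<close> divides
  \<open>v\<close> by \<open>l\<close> and multiplies \<open>\<alpha>\<close> by \<open>l\<close>.
  These are thus the coordinates of the point where the orbit meets the slice.\<close>

definition slice_coord :: "'v bispace \<Rightarrow> 'e \<times> 'e" where
  "slice_coord z = (inverse (- blinfun_apply \<alpha>0 (fst z)) *\<^sub>R L' (fst z),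
     (- blinfun_apply \<alpha>0 (fst z)) *\<^sub>R (\<Sum>b\<in>Basis. blinfun_apply (snd z) (L b) *\<^sub>R b))"

text \<open>The coefficient of \<open>\<alpha>0\<close> is forced by
  \<open>\<alpha>(v) = - 1\<close>: on the first component \<open>\<alpha>0\<close> is
  \<open>- 1\<close>, and the sum over the basis contributes
  \<open>snd x \<bullet> fst x\<close>.\<close>

definition slice_point :: "'e \<times> 'e \<Rightarrow> 'v bispace" where
  "slice_point x = (v0 + L (fst x),
     (\<Sum>b\<in>Basis. (snd x \<bullet> b) *\<^sub>R Blinfun (\<lambda>v. L' v \<bullet> b)) + (1 + snd x \<bullet> fst x) *\<^sub>R \<alpha>0)"

text \<open>The choice of representative is harmless because \<open>slice_coord\<close> is constant
  on orbits.\<close>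

definition slice_chart :: "('v bispace set, 'e \<times> 'e) chart" where
  "slice_chart = (pi_minus ` (pseudohyp \<inter> slice_domain), \<lambda>x. slice_coord (SOME z. z \<in> x))"

lemma open_slice_domain: "open slice_domain"
  unfolding slice_domain_def
  by (intro open_Collect_less continuous_intros)

lemma act_slice_domain_iff: "act t z \<in> slice_domain \<longleftrightarrow> z \<in> slice_domain"
  by (simp add: slice_domain_def blinfun.bilinear_simps mult_less_0_iff)

lemma pi_minus_slice_domain_iff:
  "z \<in> pseudohyp \<Longrightarrow> pi_minus z \<in> fst slice_chart \<longleftrightarrow> z \<in> slice_domain"
  using pi_minus_eqD[of z] act_slice_domain_iff by (auto simp: slice_chart_def) metis

lemma slice_coord_act: "slice_coord (act t z) = slice_coord z"
  by (simp add: slice_coord_def blinfun.bilinear_simps linear_cmul[OF linear_L'] exp_minus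
      scaleR_sum_right field_simps)

lemma slice_chart_pi_minus: "snd slice_chart (pi_minus z) = slice_coord z"
proof -
  have "(SOME y. y \<in> pi_minus z) \<in> pi_minus z" using mem_pi_minus by (rule someI)
  then show ?thesis by (auto simp: slice_chart_def pi_minus_def slice_coord_act)
qed

lemma L'_v0: "L' v0 = 0"
  using L'_L[of "L' v0"] by (simp add: L_L' \<alpha>0_v0 linear_0[OF linear_L'])

lemma slice_point_snd:
  "blinfun_apply (snd (slice_point x)) v = snd x \<bullet> L' v + (1 + snd x \<bullet> fst x) * blinfun_apply \<alpha>0 v"
proof -
  have "bounded_linear (\<lambda>v. L' v \<bullet> b)" for b
    using linear_L' by (intro bounded_linear_compose[OF bounded_linear_inner_left]) (simp add: linear_conv_bounded_linear)
  then show ?thesis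
    by (simp add: slice_point_def blinfun.bilinear_simps blinfun.sum_left bounded_linear_Blinfun_apply
        euclidean_inner[of "snd x" "L' v"])
qed

lemma slice_point_pseudohyp: "slice_point x \<in> pseudohyp"
  by (simp add: pseudohyp_def slice_point_snd)
    (simp add: slice_point_def linear_add[OF linear_L'] L'_v0 L'_L blinfun.add_right \<alpha>0_v0 \<alpha>0_L)

lemma slice_point_domain: "slice_point x \<in> slice_domain"
  by (simp add: slice_domain_def slice_point_def blinfun.add_right \<alpha>0_v0 \<alpha>0_L)

lemma slice_coord_point: "slice_coord (slice_point x) = x"
proof -
  have "fst (slice_point x) = v0 + L (fst x)" by (simp add: slice_point_def)
  then show ?thesis
    by (simp add: slice_coord_def slice_point_snd blinfun.add_right \<alpha>0_v0 \<alpha>0_L linear_add[OF linear_L'] L'_v0 L'_L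
        euclidean_representation prod_eq_iff)
qed

lemma pi_minus_slice_point:
  assumes z: "z \<in> pseudohyp" "z \<in> slice_domain"
  shows "pi_minus (slice_point (slice_coord z)) = pi_minus z"
proof -
  define l where "l = - blinfun_apply \<alpha>0 (fst z)"
  have l: "l > 0" using z by (simp add: slice_domain_def l_def)
  define x where "x = slice_coord z"
  have x1: "fst x = inverse l *\<^sub>R L' (fst z)" by (simp add: x_def slice_coord_def l_def)
  have x2: "snd x \<bullet> w = l * blinfun_apply (snd z) (L w)" for w
  proof -
    have "snd x \<bullet> w = l * (\<Sum>b\<in>Basis. blinfun_apply (snd z) (L b) * (b \<bullet> w))"
      by (simp add: x_def slice_coord_def l_def inner_sum_left)
    also have "(\<Sum>b\<in>Basis. blinfun_apply (snd z) (L b) * (b \<bullet> w)) = blinfun_apply (snd z) (L w)"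
      using linear_basis_expansion[OF linear_L, of w]
      by (simp add: blinfun.bilinear_simps blinfun.sum_right inner_commute mult.commute)
    finally show ?thesis .
  qed
  \<comment> \<open>Time \<open>ln l\<close> undoes the normalisation by \<open>l\<close>.\<close>
  have "act (ln l) (slice_point x) = z"
  proof (rule prod_eqI)
    show "fst (act (ln l) (slice_point x)) = fst z"
      using l by (simp add: slice_point_def x1 linear_cmul[OF linear_L] L_L' scaleR_add_right) (simp add: l_def)
    show "snd (act (ln l) (slice_point x)) = snd z"
    proof (rule blinfun_eqI)
      fix u
      have zz: "blinfun_apply (snd z) (fst z) = - 1" using z by (simp add: pseudohyp_def)
      \<comment> \<open>The equation of the hyperquadric at \<open>z\<close> turns the coefficient
        of \<open>\<alpha>0\<close> into \<open>- l\<close> times the value of \<open>snd z\<close>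
        at \<open>v0\<close>.\<close>
      have "snd x \<bullet> fst x = blinfun_apply (snd z) (L (L' (fst z)))"
        using l by (simp add: x2 x1 linear_cmul[OF linear_L] blinfun.scaleR_right)
      also have "\<dots> = - 1 - l * blinfun_apply (snd z) v0"
        by (simp add: L_L' blinfun.bilinear_simps zz l_def)
      finally have "1 + snd x \<bullet> fst x = - l * blinfun_apply (snd z) v0" by simp
      then have "blinfun_apply (snd (slice_point x)) u = l * blinfun_apply (snd z) u"
        by (simp only: slice_point_snd x2[of "L' u"]) (simp add: L_L' blinfun.bilinear_simps algebra_simps)
      then show "blinfun_apply (snd (act (ln l) (slice_point x))) u = blinfun_apply (snd z) u"
        using l by (simp add: blinfun.scaleR_left exp_minus)
    qed
  qed
  then show ?thesis using pi_minus_act x_def by metis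
qed

lemma smooth_slice_coord:
  assumes S: "open S" and k: "smooth_on S k" and dom: "\<And>x. x \<in> S \<Longrightarrow> k x \<in> slice_domain"
  shows "smooth_on S (\<lambda>x. slice_coord (k x))"
proof -
  have l: "smooth_on S (\<lambda>x. - blinfun_apply \<alpha>0 (fst (k x)))"
    by (rule smooth_on_bounded_linear[OF _ S k])
      (intro bounded_linear_minus blinfun.bounded_linear_right[THEN bounded_linear_compose] bounded_linear_fst)
  have "smooth_on S (\<lambda>x. inverse (- blinfun_apply \<alpha>0 (fst (k x))))"
    by (rule smooth_on_inverse[OF S l]) (use dom in \<open>force simp: slice_domain_def\<close>)
  moreover have "smooth_on S (\<lambda>x. L' (fst (k x)))"
    by (rule smooth_on_bounded_linear[OF _ S k])
      (use linear_L' in \<open>simp add: linear_conv_bounded_linear bounded_linear_compose[OF _ bounded_linear_fst]\<close>)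
  moreover have "smooth_on S (\<lambda>x. blinfun_apply (snd (k x)) (L b))" for b
    by (rule smooth_on_bounded_linear[OF _ S k])
      (rule bounded_linear_compose[OF blinfun.bounded_linear_left bounded_linear_snd])
  ultimately show ?thesis
    unfolding slice_coord_def
    by (intro smooth_on_Pair S smooth_on_bilinear[OF bounded_bilinear_scaleR S] smooth_on_sum smooth_on_const l)
qed

lemma smooth_slice_point: "smooth_on UNIV slice_point"
  unfolding slice_point_def
proof (intro smooth_on_Pair open_UNIV smooth_on_add smooth_on_const smooth_on_sum
    smooth_on_bilinear[OF bounded_bilinear_scaleR] smooth_on_bilinear[OF bounded_bilinear_inner])
  show "smooth_on UNIV (\<lambda>x. L (fst x))"
    by (rule smooth_on_bounded_linear[OF _ open_UNIV smooth_on_ident[OF open_UNIV]])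
      (use linear_L in \<open>simp add: linear_conv_bounded_linear bounded_linear_compose[OF _ bounded_linear_fst]\<close>)
qed (auto intro: smooth_on_bounded_linear[OF bounded_linear_fst open_UNIV smooth_on_ident]
    smooth_on_bounded_linear[OF bounded_linear_snd open_UNIV smooth_on_ident])

text \<open>\<open>slice_coord\<close> is the smooth extension and \<open>slice_point\<close> the
  smooth section required of a chart; the coordinates fill the model space.\<close>

lemma slice_chart_atlas: "slice_chart \<in> parahyp_atlas"
proof -
  have pre: "{z \<in> pseudohyp. pi_minus z \<in> fst slice_chart} = pseudohyp \<inter> slice_domain"
    using pi_minus_slice_domain_iff by auto
  have dom: "\<exists>z. z \<in> pseudohyp \<and> z \<in> slice_domain \<and> x = pi_minus z" if "x \<in> fst slice_chart" for x
    using that by (auto simp: slice_chart_def)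
  have "openin parahyp_topology (fst slice_chart)"
    unfolding openin_parahyp_topology pre
    by (auto simp: slice_chart_def parahyp_def openin_open_Int open_slice_domain)
  moreover have "inj_on (snd slice_chart) (fst slice_chart)"
  proof (rule inj_onI)
    fix x y assume "x \<in> fst slice_chart" "y \<in> fst slice_chart" and e: "snd slice_chart x = snd slice_chart y"
    from dom[OF this(1)] dom[OF this(2)] obtain z w
      where "z \<in> pseudohyp" "z \<in> slice_domain" "x = pi_minus z" "w \<in> pseudohyp" "w \<in> slice_domain" "y = pi_minus w"
      by blast
    then show "x = y" using e pi_minus_slice_point[of z] pi_minus_slice_point[of w] by (simp add: slice_chart_pi_minus)
  qed
  moreover have sec: "slice_point y \<in> pseudohyp \<and> pi_minus (slice_point y) \<in> fst slice_chart \<and>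
      snd slice_chart (pi_minus (slice_point y)) = y" for y
    using slice_point_pseudohyp slice_point_domain
    by (simp add: pi_minus_slice_domain_iff slice_chart_pi_minus slice_coord_point)
  moreover from this have "snd slice_chart ` fst slice_chart = UNIV" by (metis UNIV_eq_I imageI)
  moreover have "\<exists>W G. open W \<and> z \<in> W \<and> smooth_on W G \<and>
      (\<forall>y\<in>W \<inter> pseudohyp. pi_minus y \<in> fst slice_chart \<longrightarrow> G y = snd slice_chart (pi_minus y))"
    if "z \<in> pseudohyp" "pi_minus z \<in> fst slice_chart" for z
    using that smooth_slice_coord[OF open_slice_domain smooth_on_ident[OF open_slice_domain]] open_slice_domain
    by (intro exI[of _ slice_domain] exI[of _ slice_coord])
      (auto simp: pi_minus_slice_domain_iff slice_chart_pi_minus)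
  moreover have "\<exists>W s. open W \<and> x \<in> W \<and> smooth_on W s \<and>
      (\<forall>y\<in>W. s y \<in> pseudohyp \<and> pi_minus (s y) \<in> fst slice_chart \<and> snd slice_chart (pi_minus (s y)) = y)" for x
    using smooth_slice_point sec by (intro exI[of _ UNIV] exI[of _ slice_point]) simp
  ultimately show ?thesis
    by (simp add: parahyp_atlas_def case_prod_unfold)
qed

end

text \<open>\<open>L\<close> is an isomorphism onto the kernel of \<open>\<alpha>0\<close>, and
  \<open>L'\<close> is its inverse after projection along \<open>v0\<close>; since
  \<open>\<alpha>0 v0 = - 1\<close>, this projection adds \<open>\<alpha>0 v\<close> times
  \<open>v0\<close>.\<close>

lemma quotient_slice_ex:
  fixes v0 :: "'v::euclidean_space"
  assumes dim: "DIM('v) = DIM('e::euclidean_space) + 1" and z: "(v0, \<alpha>0) \<in> pseudohyp"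
  obtains L L' where "quotient_slice v0 \<alpha>0 (L :: 'e \<Rightarrow> 'v) L'"
proof -
  have \<alpha>0v0: "blinfun_apply \<alpha>0 v0 = - 1" using z by (simp add: pseudohyp_def)
  \<comment> \<open>The vector representing \<open>\<alpha>0\<close>, so that the kernel is a
    hyperplane of known dimension.\<close>
  define a where "a = (\<Sum>b\<in>Basis. blinfun_apply \<alpha>0 b *\<^sub>R b)"
  have a: "blinfun_apply \<alpha>0 v = a \<bullet> v" for v
    using linear_basis_expansion[OF bounded_linear.linear[OF blinfun.bounded_linear_right], of \<alpha>0 v]
    by (simp add: a_def inner_sum_left inner_sum_right inner_commute mult.commute)
  let ?K = "{v. a \<bullet> v = 0}"
  have "a \<noteq> 0" using \<alpha>0v0 a[of v0] by auto
  then have "dim ?K = dim (UNIV :: 'e set)" using dim_hyperplane[of a] dim by simp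
  then obtain L :: "'e \<Rightarrow> 'v" where L: "linear L" "L ` UNIV = ?K" "inj L"
    using subspace_isomorphism[OF subspace_UNIV subspace_hyperplane[of a]] by metis
  obtain g where g: "linear g" "g \<circ> L = id" using linear_injective_left_inverse[OF L(1,3)] by blast
  define L' where "L' v = g (v + blinfun_apply \<alpha>0 v *\<^sub>R v0)" for v
  have "quotient_slice v0 \<alpha>0 L L'"
  proof (rule quotient_slice.intro)
    show "linear L'"
      by (rule linearI) (simp_all add: L'_def blinfun.bilinear_simps algebra_simps
          flip: linear_add[OF g(1)] linear_cmul[OF g(1)])
    show \<alpha>L: "blinfun_apply \<alpha>0 (L x) = 0" for x using L(2) by (auto simp: a)
    show "L' (L x) = x" for x using g(2) by (simp add: L'_def \<alpha>L fun_eq_iff)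
    show "L (L' v) = v + blinfun_apply \<alpha>0 v *\<^sub>R v0" for v
    proof -
      have "v + blinfun_apply \<alpha>0 v *\<^sub>R v0 \<in> ?K"
        using \<alpha>0v0 by (simp add: blinfun.bilinear_simps flip: a)
      then obtain x where "v + blinfun_apply \<alpha>0 v *\<^sub>R v0 = L x" using L(2) by blast
      then show ?thesis using g(2) by (simp add: L'_def fun_eq_iff)
    qed
  qed (use \<alpha>0v0 L(1) in auto)
  then show ?thesis by (rule that)
qed

section \<open>Horizontal immersions and their projections\<close>

text \<open>The slice through \<open>z\<close> itself gives such a chart, which makes the choice in
  \<open>chart_at\<close> land in the atlas.\<close>

lemma parahyp_chart_ex:
  fixes z :: "'v::euclidean_space bispace"
  assumes "DIM('v) = DIM('e::euclidean_space) + 1" and "z \<in> pseudohyp"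
  shows "\<exists>c. c \<in> (parahyp_atlas :: ('v bispace set, 'e \<times> 'e) chart set) \<and> pi_minus z \<in> fst c"
proof -
  from assms(2) obtain L :: "'e \<Rightarrow> 'v" and L' where "quotient_slice (fst z) (snd z) L L'"
    by (cases z) (auto elim: quotient_slice_ex[OF assms(1)])
  then interpret quotient_slice "fst z" "snd z" L L' .
  have "z \<in> slice_domain" by (simp add: slice_domain_def \<alpha>0_v0)
  then show ?thesis using slice_chart_atlas pi_minus_slice_domain_iff[OF assms(2)] by blast
qed

section \<open>The differential of the projection on horizontal vectors\<close>

text \<open>\<open>c\<close> is whichever chart \<open>chart_at\<close> picks from the maximal
  atlas, so the arguments rest on the atlas conditions and not on slices.\<close>

locale parahyp_point =
  fixes z :: "'v::euclidean_space bispace" and c :: "('v bispace set, 'e::euclidean_space) chart"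
  assumes z: "z \<in> pseudohyp" and c: "c \<in> parahyp_atlas" "pi_minus z \<in> fst c"
    and c_def: "c = chart_at parahyp_atlas (pi_minus z)"
begin

abbreviation D :: "'v bispace \<Rightarrow> 'e" where "D \<equiv> dpi_minus z"

lemma openin_chart: "openin parahyp_topology (fst c)"
  and inj_chart: "inj_on (snd c) (fst c)"
  and chart_smooth: "\<And>y. y \<in> pseudohyp \<Longrightarrow> pi_minus y \<in> fst c \<Longrightarrow>
        \<exists>W G. open W \<and> y \<in> W \<and> smooth_on W G \<and>
           (\<forall>y\<in>W \<inter> pseudohyp. pi_minus y \<in> fst c \<longrightarrow> G y = snd c (pi_minus y))"
  and chart_section: "\<And>x. x \<in> snd c ` fst c \<Longrightarrow> \<exists>W s. open W \<and> x \<in> W \<and> smooth_on W s \<and>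
        (\<forall>y\<in>W. s y \<in> pseudohyp \<and> pi_minus (s y) \<in> fst c \<and> snd c (pi_minus (s y)) = y)"
  using c(1) by (auto simp: parahyp_atlas_def)

lemma chart_preimage_open:
  obtains T where "open T" "\<And>y. y \<in> pseudohyp \<Longrightarrow> pi_minus y \<in> fst c \<longleftrightarrow> y \<in> T"
proof -
  have "openin (top_of_set pseudohyp) {y \<in> pseudohyp. pi_minus y \<in> fst c}"
    using openin_chart by (simp add: openin_parahyp_topology)
  then obtain T where "open T" "{y \<in> pseudohyp. pi_minus y \<in> fst c} = pseudohyp \<inter> T"
    by (auto simp: openin_open)
  then show ?thesis by (intro that[of T]) auto
qed

text \<open>The local extension \<open>G\<close> shows that a derivative within the hyperquadric
  exists; \<open>frechet_derivative\<close> then selects one.\<close>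

lemma dpi_minus_has_derivative:
  "((snd c \<circ> pi_minus) has_derivative D) (at z within pseudohyp)"
proof -
  obtain W G where G: "open W" "z \<in> W" "smooth_on W G"
    "\<And>y. y \<in> W \<Longrightarrow> y \<in> pseudohyp \<Longrightarrow> pi_minus y \<in> fst c \<Longrightarrow> G y = snd c (pi_minus y)"
    using chart_smooth[OF z c(2)] by blast
  obtain T where T: "open T" "\<And>y. y \<in> pseudohyp \<Longrightarrow> pi_minus y \<in> fst c \<longleftrightarrow> y \<in> T"
    using chart_preimage_open by blast
  obtain d where d: "d > 0" "ball z d \<subseteq> W \<inter> T"
    using G T z c(2) by (meson IntI open_Int open_contains_ball)
  have "(G has_derivative frechet_derivative G (at z)) (at z within pseudohyp)"
    using smooth_on_has_derivative[OF G(3,2)] by (rule has_derivative_at_withinI)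
  then have "((snd c \<circ> pi_minus) has_derivative frechet_derivative G (at z)) (at z within pseudohyp)"
    by (rule has_derivative_transform_within[OF _ d(1) z])
      (use d G T in \<open>auto simp: subset_eq dist_commute\<close>)
  then show ?thesis
    unfolding dpi_minus_def c_def[symmetric] by (metis differentiable_def frechet_derivative_works)
qed

lemma linear_dpi_minus: "linear D"
  using dpi_minus_has_derivative by (rule has_derivative_linear)

lemma dpi_minus_curve:
  assumes k: "(k has_derivative k') (at x)" "k x = z" and S: "open S" "x \<in> S"
    and mem: "\<And>y. y \<in> S \<Longrightarrow> k y \<in> pseudohyp"
  shows "((snd c \<circ> pi_minus \<circ> k) has_derivative D \<circ> k') (at x)"
proof -
  have "((snd c \<circ> pi_minus) has_derivative D) (at (k x) within k ` S)"
    unfolding k(2) using mem by (intro has_derivative_subset[OF dpi_minus_has_derivative]) auto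
  from diff_chain_within[OF has_derivative_at_withinI[OF k(1)] this] show ?thesis
    by (simp only: at_within_open[OF S(2,1)])
qed

lemma horizontal_curve:
  assumes X: "X \<in> horizontal z"
  obtains k :: "real \<Rightarrow> 'v bispace" and S where "open S" "0 \<in> S" "k 0 = z"
    "(k has_derivative (\<lambda>h. h *\<^sub>R X)) (at 0)" "\<And>t. t \<in> S \<Longrightarrow> k t \<in> pseudohyp"
proof -
  let ?b = "blinfun_apply (snd X) (fst X)"
  \<comment> \<open>The line \<open>z + t X\<close> has pairing
    \<open>- (1 - t\<^sup>2 * ?b)\<close>. Dividing the covector by
    \<open>1 - t\<^sup>2 * ?b\<close> returns it to the hyperquadric and, this factor being 1 to
    first order, keeps the velocity \<open>X\<close>.\<close>
  define k where "k = (\<lambda>t::real. (fst z + t *\<^sub>R fst X, inverse (1 - t\<^sup>2 * ?b) *\<^sub>R (snd z + t *\<^sub>R snd X)))"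
  let ?S = "{t. 1 - t\<^sup>2 * ?b \<noteq> (0::real)}"
  have "open ?S" by (intro open_Collect_neq continuous_intros)
  moreover have "(k has_derivative (\<lambda>h. (h *\<^sub>R fst X, h *\<^sub>R snd X))) (at 0)"
    unfolding k_def by (auto intro!: derivative_eq_intros)
  moreover have "k t \<in> pseudohyp" if "t \<in> ?S" for t
  proof -
    have nz: "1 - t\<^sup>2 * ?b \<noteq> 0" using that by simp
    have *: "blinfun_apply (snd z + t *\<^sub>R snd X) (fst z + t *\<^sub>R fst X) = - (1 - t\<^sup>2 * ?b)"
      using X z by (simp add: horizontal_iff pseudohyp_def blinfun.bilinear_simps power2_eq_square)
    show ?thesis
      by (simp only: k_def pseudohyp_def mem_Collect_eq fst_conv snd_conv blinfun.scaleR_left *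
          real_scaleR_def mult_minus_right left_inverse[OF nz])
  qed
  ultimately show ?thesis by (intro that[of ?S k]) (auto simp: k_def scaleR_prod_def)
qed

lemma dpi_minus_horizontal_eq_0:
  assumes X: "X \<in> horizontal z" and D: "D X = 0"
  shows "X = 0"
proof -
  obtain k S where S: "open S" "0 \<in> S" and k: "k 0 = z"
    "(k has_derivative (\<lambda>h::real. h *\<^sub>R X)) (at 0)" "\<And>t. t \<in> S \<Longrightarrow> k t \<in> pseudohyp"
    using horizontal_curve[OF X] by metis
  \<comment> \<open>The projected curve in the chart; \<open>D X = 0\<close> makes it stationary at
    0.\<close>
  define x where "x = (\<lambda>t. snd c (pi_minus (k t)))"
  have x': "(x has_derivative (\<lambda>h. 0)) (at 0)"
    using dpi_minus_curve[OF k(2,1) S k(3)] linear_cmul[OF linear_dpi_minus, of _ X] D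
    by (simp add: x_def o_def)
  have "x 0 \<in> snd c ` fst c" using c(2) k(1) by (simp add: x_def)
  then obtain W s where s: "open W" "x 0 \<in> W" "smooth_on W s"
    "\<And>y. y \<in> W \<Longrightarrow> s y \<in> pseudohyp \<and> pi_minus (s y) \<in> fst c \<and> snd c (pi_minus (s y)) = y"
    using chart_section by meson
  obtain T where T: "open T" "\<And>y. y \<in> pseudohyp \<Longrightarrow> pi_minus y \<in> fst c \<longleftrightarrow> y \<in> T"
    using chart_preimage_open by blast
  have "z \<in> T" using T(2) z c(2) by simp
  have "isCont x 0" "isCont k 0"
    using x' k(2) has_derivative_continuous by blast+
  then have "\<forall>\<^sub>F t in nhds 0. x t \<in> W" "\<forall>\<^sub>F t in nhds 0. k t \<in> T" "\<forall>\<^sub>F t in nhds 0. t \<in> S"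
    using s(1,2) T(1) \<open>z \<in> T\<close> k(1) S
    by (auto simp: eventually_nhds_in_open isCont_def tendsto_at_iff_tendsto_nhds intro: topological_tendstoD)
  \<comment> \<open>By injectivity of the chart, the curve and the section over its chart image
    share their orbits near 0.\<close>
  then have "\<forall>\<^sub>F t in nhds 0. \<exists>r. k t = act r (s (x t))"
  proof eventually_elim
    case (elim t)
    then have "pi_minus (k t) = pi_minus (s (x t))"
      using inj_onD[OF inj_chart, of "pi_minus (k t)" "pi_minus (s (x t))"] s(4)[of "x t"] T(2)[of "k t"] k(3)[of t]
      by (simp add: x_def)
    then show ?case by (rule pi_minus_eqD)
  qed
  then obtain N where N: "open N" "0 \<in> N" "\<And>t. t \<in> N \<Longrightarrow> x t \<in> W \<and> (\<exists>r. k t = act r (s (x t)))"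
    using \<open>\<forall>\<^sub>F t in nhds 0. x t \<in> W\<close> unfolding eventually_nhds by (metis IntE IntI open_Int)
  define p where "p = (\<lambda>t. s (x t))"
  have p': "(p has_derivative (\<lambda>h. 0)) (at 0)"
    using has_derivative_compose[OF x' smooth_on_has_derivative[OF s(3,2)]]
      linear_0[OF has_derivative_linear[OF smooth_on_has_derivative[OF s(3,2)]]] by (simp add: p_def)
  have p1: "((\<lambda>t. fst (p t)) has_derivative (\<lambda>h. 0)) (at 0)" and p2: "((\<lambda>t. snd (p t)) has_derivative (\<lambda>h. 0)) (at 0)"
    using has_derivative_fst[OF p'] has_derivative_snd[OF p'] by simp_all
  have k1: "((\<lambda>t. fst (k t)) has_derivative (\<lambda>h. h *\<^sub>R fst X)) (at 0)"
    and k2: "((\<lambda>t. snd (k t)) has_derivative (\<lambda>h. h *\<^sub>R snd X)) (at 0)"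
    using has_derivative_fst[OF k(2)] has_derivative_snd[OF k(2)] by simp_all
  note app = bounded_bilinear.FDERIV[OF bounded_bilinear_blinfun_apply]
  \<comment> \<open>The orbit parameter \<open>r\<close> depends on \<open>t\<close> in an unknown
    way. It is eliminated: on the hyperquadric the two pairings equal \<open>exp r\<close> and
    \<open>exp (- r)\<close>.\<close>
  have rel: "fst (k t) = - blinfun_apply (snd (p t)) (fst (k t)) *\<^sub>R fst (p t)"
    "snd (k t) = - blinfun_apply (snd (k t)) (fst (p t)) *\<^sub>R snd (p t)" if t: "t \<in> N" for t
  proof -
    obtain r where "k t = act r (p t)" using N(3)[OF t] by (auto simp: p_def)
    moreover have "blinfun_apply (snd (p t)) (fst (p t)) = - 1"
      using N(3)[OF t] s(4)[of "x t"] by (simp add: p_def pseudohyp_def)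
    ultimately show "fst (k t) = - blinfun_apply (snd (p t)) (fst (k t)) *\<^sub>R fst (p t)"
      "snd (k t) = - blinfun_apply (snd (k t)) (fst (p t)) *\<^sub>R snd (p t)"
      by (simp_all add: blinfun.bilinear_simps)
  qed
  obtain r where r: "z = act r (p 0)" using N(2,3) k(1) p_def by force
  \<comment> \<open>\<open>z\<close> and \<open>p 0\<close> lie on one orbit, so horizontality of
    \<open>X\<close> passes to \<open>p 0\<close>.\<close>
  have z0: "blinfun_apply (snd (p 0)) (fst X) = 0" "blinfun_apply (snd X) (fst (p 0)) = 0"
    using X by (simp_all add: r horizontal_iff blinfun.bilinear_simps)
  \<comment> \<open>All terms of the product rule vanish: \<open>p\<close> is stationary, and the
    remaining one pairs \<open>snd (p 0)\<close> with \<open>fst X\<close>.\<close>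
  have "((\<lambda>t. - blinfun_apply (snd (p t)) (fst (k t)) *\<^sub>R fst (p t)) has_derivative (\<lambda>h. 0)) (at 0)"
    using bounded_bilinear.FDERIV[OF bounded_bilinear_scaleR has_derivative_minus[OF app[OF p2 k1]] p1]
    by (simp add: blinfun.bilinear_simps z0)
  then have "((\<lambda>t. fst (k t)) has_derivative (\<lambda>h. 0)) (at 0)"
    by (rule has_derivative_transform_within_open[OF _ N(1,2)]) (rule rel(1)[symmetric])
  from has_derivative_unique[OF this k1] have "fst X = 0" by (metis scaleR_one)
  moreover have "((\<lambda>t. - blinfun_apply (snd (k t)) (fst (p t)) *\<^sub>R snd (p t)) has_derivative (\<lambda>h. 0)) (at 0)"
    using bounded_bilinear.FDERIV[OF bounded_bilinear_scaleR has_derivative_minus[OF app[OF k2 p1]] p2]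
    by (simp add: blinfun.bilinear_simps z0)
  then have "((\<lambda>t. snd (k t)) has_derivative (\<lambda>h. 0)) (at 0)"
    by (rule has_derivative_transform_within_open[OF _ N(1,2)]) (rule rel(2)[symmetric])
  from has_derivative_unique[OF this k2] have "snd X = 0" by (metis scaleR_one)
  ultimately show ?thesis by (simp add: prod_eq_iff)
qed

lemma inj_on_dpi_minus: "inj_on D (horizontal z)"
proof (rule inj_onI)
  fix X Y assume XY: "X \<in> horizontal z" "Y \<in> horizontal z" "D X = D Y"
  then have "X - Y \<in> horizontal z" by (simp add: horizontal_iff blinfun.bilinear_simps)
  moreover have "D (X - Y) = 0" using XY by (simp add: linear_diff[OF linear_dpi_minus])
  ultimately show "X = Y" using dpi_minus_horizontal_eq_0[of "X - Y"] by simp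
qed

lemma horizontal_lift_dpi_minus: "X \<in> horizontal z \<Longrightarrow> horizontal_lift z (D X) = X"
  unfolding horizontal_lift_def by (rule the_inv_into_f_f[OF inj_on_dpi_minus])

end

section \<open>Projecting horizontal immersions to the quotient\<close>

locale horizontal_immersion = smooth_mfd M A
  for M :: "'a topology" and A :: "('a, real^'n) chart set" +
  fixes \<sigma> :: "'a \<Rightarrow> 'v::euclidean_space bispace"
  assumes dim: "DIM('v) = CARD('n) + 1"
    and immersion: "immersion_into_pseudohyp M A \<sigma>"
    and horizontal: "is_horizontal M A \<sigma>"
begin

abbreviation (input) B :: "('v bispace set, (real^'n) \<times> (real^'n)) chart set" where "B \<equiv> parahyp_atlas"
abbreviation (input) F where "F \<equiv> pi_minus \<circ> \<sigma>"

lemma smooth: "smooth_map A \<sigma>" and inj: "p \<in> topspace M \<Longrightarrow> inj (mdiff A \<sigma> p)"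
  and mem_pseudohyp: "p \<in> topspace M \<Longrightarrow> \<sigma> p \<in> pseudohyp"
  using immersion by (auto simp: immersion_into_pseudohyp_def immersion_def)

text \<open>The tensors on the quotient are evaluated at the point chosen by \<open>SOME\<close>,
  which need not be \<open>\<sigma> p\<close>. Translating all of \<open>\<sigma>\<close> by one
  \<open>t\<close> passes through that point with the same projection, so the differential can be
  computed there.\<close>

lemma representative:
  assumes p: "p \<in> topspace M"
  obtains t where "(SOME z. z \<in> F p) = act t (\<sigma> p)"
    "parahyp_point (act t (\<sigma> p)) (chart_at B (F p))"
    "\<And>X. mdiff2 A B F p X = dpi_minus (act t (\<sigma> p)) (act t (mdiff A \<sigma> p X))"
    "\<And>X. act t (mdiff A \<sigma> p X) \<in> horizontal (act t (\<sigma> p))"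
proof -
  have "(SOME z. z \<in> F p) \<in> F p" using mem_pi_minus[of "\<sigma> p"] by (intro someI) simp
  then obtain t where t: "(SOME z. z \<in> F p) = act t (\<sigma> p)" by (auto simp: pi_minus_def)
  let ?z = "act t (\<sigma> p)" and ?c = "chart_at A p"
  have z: "?z \<in> pseudohyp" by (rule act_pseudohyp[OF mem_pseudohyp[OF p]])
  have "\<exists>c. c \<in> B \<and> pi_minus ?z \<in> fst c"
    by (rule parahyp_chart_ex[OF _ z]) (simp add: dim)
  from someI_ex[OF this] have P: "parahyp_point ?z (chart_at B (F p))"
    by unfold_locales (use z in \<open>simp_all add: chart_at_def pi_minus_act\<close>)
  then interpret parahyp_point ?z "chart_at B (F p)" .
  note c' = chart_at_mem[OF p] mem_chart_at[OF p]
  let ?k = "\<lambda>x. act t ((\<sigma> \<circ> chart_inv ?c) x)"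
  have "((snd (chart_at B (F p)) \<circ> pi_minus \<circ> ?k) has_derivative D \<circ> (\<lambda>X. act t (mdiff A \<sigma> p X))) (at (snd ?c p))"
  proof (rule dpi_minus_curve)
    show "(?k has_derivative (\<lambda>X. act t (mdiff A \<sigma> p X))) (at (snd ?c p))"
      by (rule bounded_linear.has_derivative[OF bounded_linear_act smooth_map_has_derivative_mdiff[OF smooth p]])
    show "open (snd ?c ` fst ?c)" by (rule open_chart_range[OF c'(1)])
    show "?k y \<in> pseudohyp" if "y \<in> snd ?c ` fst ?c" for y
      using that c' chart_domain_point[OF c'(1)] by (auto intro!: act_pseudohyp mem_pseudohyp)
  qed (use c' in auto)
  moreover have "snd (chart_at B (F p)) \<circ> pi_minus \<circ> ?k = (snd (chart_at B (F p)) \<circ> F) \<circ> chart_inv ?c"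
    by (simp add: fun_eq_iff pi_minus_act)
  ultimately have "mdiff2 A B F p = D \<circ> (\<lambda>X. act t (mdiff A \<sigma> p X))"
    unfolding mdiff2_def mdiff_def[of A "snd (chart_at B (F p)) \<circ> F"] by (metis frechet_derivative_at)
  moreover have "act t (mdiff A \<sigma> p X) \<in> horizontal (act t (\<sigma> p))" for X
    using horizontal p by (intro horizontal_act) (simp add: is_horizontal_def)
  ultimately show ?thesis using t P by (intro that[of t]) simp_all
qed

text \<open>Smoothness asks for some chart around each image point; the slice through
  \<open>\<sigma> p\<close> provides it.\<close>

lemma smooth_projection: "smooth_map2 M A B F"
  unfolding smooth_map2_def
proof
  fix p assume p: "p \<in> topspace M"
  note z = mem_pseudohyp[OF p]
  obtain L :: "real^'n \<Rightarrow> 'v" and L' where "quotient_slice (fst (\<sigma> p)) (snd (\<sigma> p)) L L'"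
    using quotient_slice_ex[where 'e = "real^'n", of "fst (\<sigma> p)" "snd (\<sigma> p)"] z dim by auto
  then interpret quotient_slice "fst (\<sigma> p)" "snd (\<sigma> p)" L L' .
  let ?c = "chart_at A p"
  note c = chart_at_mem[OF p] mem_chart_at[OF p]
  let ?W = "{q \<in> fst ?c. \<sigma> q \<in> slice_domain}"
  have W: "openin M ?W" by (rule openin_smooth_map_preimage[OF smooth c(1) open_slice_domain])
  have p_dom: "\<sigma> p \<in> slice_domain" by (simp add: slice_domain_def \<alpha>0_v0)
  have dom: "\<sigma> q \<in> pseudohyp" if "q \<in> ?W" for q
    using that chart_domain_point[OF c(1)] mem_pseudohyp by auto
  have img: "snd ?c ` (fst ?c \<inter> ?W) = snd ?c ` ?W" by auto
  have S: "open (snd ?c ` ?W)" using open_chart_image[OF c(1) W] by (simp only: img)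
  have sm: "smooth_on (snd ?c ` ?W) (\<sigma> \<circ> chart_inv ?c)"
    by (rule smooth_on_subset[OF smooth_mapD[OF smooth c(1)]]) auto
  have "smooth_on (snd ?c ` ?W) (\<lambda>x. slice_coord ((\<sigma> \<circ> chart_inv ?c) x))"
    by (rule smooth_slice_coord[OF S sm]) (use c in auto)
  then have "smooth_on (snd ?c ` ?W) (snd slice_chart \<circ> F \<circ> chart_inv ?c)"
    by (simp add: o_def slice_chart_pi_minus)
  moreover have "F ` ?W \<subseteq> fst slice_chart"
    using dom by (auto simp: pi_minus_slice_domain_iff)
  ultimately show "\<exists>c\<in>A. \<exists>d\<in>B. \<exists>W. openin M W \<and> p \<in> W \<and> W \<subseteq> fst c \<and> F ` W \<subseteq> fst d \<and>
        smooth_on (snd c ` W) (snd d \<circ> F \<circ> chart_inv c)"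
    using c W p_dom slice_chart_atlas
    by (intro bexI[of _ ?c] bexI[of _ slice_chart] exI[of _ ?W]) auto
qed

lemma immersion_projection: "immersion2 M A B F"
  unfolding immersion2_def
proof (intro conjI ballI smooth_projection)
  fix p assume p: "p \<in> topspace M"
  obtain t where t: "parahyp_point (act t (\<sigma> p)) (chart_at B (F p))"
    "\<And>X. mdiff2 A B F p X = dpi_minus (act t (\<sigma> p)) (act t (mdiff A \<sigma> p X))"
    "\<And>X. act t (mdiff A \<sigma> p X) \<in> horizontal (act t (\<sigma> p))"
    using representative[OF p] by metis
  interpret parahyp_point "act t (\<sigma> p)" "chart_at B (F p)" by (rule t(1))
  show "inj (mdiff2 A B F p)"
  proof (rule injI)
    fix X Y assume "mdiff2 A B F p X = mdiff2 A B F p Y"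
    then have "act t (mdiff A \<sigma> p X) = act t (mdiff A \<sigma> p Y)"
      using inj_onD[OF inj_on_dpi_minus] t(2,3) by metis
    then have "act (- t) (act t (mdiff A \<sigma> p X)) = act (- t) (act t (mdiff A \<sigma> p Y))" by simp
    then show "X = Y" using injD[OF inj[OF p]] by (simp add: act_act act_0)
  qed
qed

text \<open>The horizontal lift is the translate of \<open>\<sigma>\<^sub>*X\<close>, and the action
  preserves the metric.\<close>

lemma pullback_metric:
  assumes p: "p \<in> topspace M"
  shows "pullback_form A B F parahyp_metric p X Y = induced_metric A \<sigma> p X Y"
proof -
  obtain t where t: "(SOME z. z \<in> F p) = act t (\<sigma> p)" "parahyp_point (act t (\<sigma> p)) (chart_at B (F p))"
    "\<And>X. mdiff2 A B F p X = dpi_minus (act t (\<sigma> p)) (act t (mdiff A \<sigma> p X))"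
    "\<And>X. act t (mdiff A \<sigma> p X) \<in> horizontal (act t (\<sigma> p))"
    using representative[OF p] by metis
  interpret parahyp_point "act t (\<sigma> p)" "chart_at B (F p)" by (rule t(2))
  show ?thesis
    by (simp only: pullback_form_def parahyp_metric_def Let_def t(1,3) horizontal_lift_dpi_minus[OF t(4)]
        neutral_metric_act induced_metric_def)
qed

text \<open>As for the metric; moreover \<open>phi\<close> preserves horizontal vectors and commutes
  with the translation on them, so lifting undoes \<open>dpi_minus\<close> again.\<close>

lemma pullback_omega:
  assumes p: "p \<in> topspace M"
  shows "pullback_form A B F parahyp_omega p X Y =
    neutral_metric (mdiff A \<sigma> p X) (phi (\<sigma> p) (mdiff A \<sigma> p Y))"
proof -
  obtain t where t: "(SOME z. z \<in> F p) = act t (\<sigma> p)" "parahyp_point (act t (\<sigma> p)) (chart_at B (F p))"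
    "\<And>X. mdiff2 A B F p X = dpi_minus (act t (\<sigma> p)) (act t (mdiff A \<sigma> p X))"
    "\<And>X. act t (mdiff A \<sigma> p X) \<in> horizontal (act t (\<sigma> p))"
    using representative[OF p] by metis
  interpret parahyp_point "act t (\<sigma> p)" "chart_at B (F p)" by (rule t(2))
  let ?z = "act t (\<sigma> p)"
  have Y: "mdiff A \<sigma> p Y \<in> horizontal (\<sigma> p)" using horizontal p by (simp add: is_horizontal_def)
  have phi: "phi ?z (act t (mdiff A \<sigma> p Y)) = act t (phi (\<sigma> p) (mdiff A \<sigma> p Y))"
    by (simp add: phi_horizontal[OF t(4)] phi_horizontal[OF Y] prod_eq_iff)
  have "phi (\<sigma> p) (mdiff A \<sigma> p Y) \<in> horizontal (\<sigma> p)"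
    using Y by (simp add: phi_horizontal[OF Y] horizontal_iff blinfun.minus_left)
  from horizontal_act[OF this] have "act t (phi (\<sigma> p) (mdiff A \<sigma> p Y)) \<in> horizontal ?z" .
  then show ?thesis
    by (simp only: pullback_form_def parahyp_omega_def parahyp_P_def parahyp_metric_def Let_def t(1,3) phi
        horizontal_lift_dpi_minus t(4) neutral_metric_act)
qed

text \<open>By symmetry of the metric, the pulled-back form vanishes exactly as anti-invariance
  says, with the arguments exchanged.\<close>

lemma lagrangian_projection:
  assumes "phi_anti_invariant M A \<sigma>"
  shows "lagrangian_immersion M A F"
  using immersion_projection assms
  by (simp add: lagrangian_immersion_def phi_anti_invariant_def pullback_omega neutral_metric_commute)

lemma nondegenerate_projection:
  assumes "\<And>p. p \<in> topspace M \<Longrightarrow> nondegenerate_form (induced_metric A \<sigma> p)"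
  shows "nondegenerate_immersion M A F"
  using immersion_projection assms
  by (simp add: nondegenerate_immersion_def nondegenerate_form_def pullback_metric)

end

theorem theoremA:
  fixes M :: "'a topology" and A :: "('a, real^'n) chart set"
    and f \<xi> :: "'a \<Rightarrow> real^'m"
  assumes dim: "CARD('m) = CARD('n) + 1"
    and manifold: "oriented_manifold M A"
    and equiaffine: "equiaffine_immersion M A f \<xi>"
    and nondegenerate: "nondegenerate_affine M A f \<xi>"
    and det_shape: "\<And>p. p \<in> topspace M \<Longrightarrow> det (matrix (affine_shape A f \<xi> p)) \<noteq> 0"
  shows "immersion_into_pseudohyp M A (sigma_minus A f \<xi>) \<and>
    is_horizontal M A (sigma_minus A f \<xi>) \<and>
    phi_anti_invariant M A (sigma_minus A f \<xi>) \<and>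
    (\<forall>p\<in>topspace M. \<forall>X Y.
       induced_metric A (sigma_minus A f \<xi>) p X Y =
         affine_metric M A (conormal A f \<xi>) (conormal A f \<xi>) p X Y \<and>
       induced_metric A (sigma_minus A f \<xi>) p X Y = - dual_form M A f \<xi> p X Y) \<and>
    lagrangian_immersion M A (pi_minus \<circ> sigma_minus A f \<xi>) \<and>
    nondegenerate_immersion M A (pi_minus \<circ> sigma_minus A f \<xi>)"
proof -
  interpret equiaffine_mfd M A f \<xi>
    by unfold_locales (use assms in \<open>simp_all add: oriented_manifold_def\<close>)
  have horizontal: "is_horizontal M A \<sigma>" by (simp add: is_horizontal_def \<sigma>_horizontal)
  have anti: "phi_anti_invariant M A \<sigma>" by (simp add: phi_anti_invariant_def neutral_metric_phi_\<sigma>)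
  interpret projection: horizontal_immersion M A \<sigma>
    by unfold_locales (use dim immersion_\<sigma> horizontal in simp_all)
  show ?thesis
    using immersion_\<sigma> horizontal anti induced_metric_\<sigma> affine_metric_conormal induced_metric_\<sigma>_dual_form
      projection.lagrangian_projection[OF anti]
      projection.nondegenerate_projection[OF nondegenerate_induced_metric_\<sigma>]
    by simp
qed

end
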